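(* Let $\Omega$, $\{\Omega_\ell\}_{\ell=1}^N$, $\{\chi_\ell\}_{\ell=1}^N$, $k$, $f$, $g$, the sesquilinear forms $a$, $a_\ell$, the finite element spaces $\mathcal{V}^h$, $\mathcal{V}^h_\ell$ and the operators $\mathcal{A}_h$, $F_h$, $\mathcal{A}_{h,\ell}$, $\mathcal{R}_{h,\ell}$, $\mathcal{R}_{h,\ell}^\top$, $\widetilde{\mathcal{R}}_{h,\ell}^\top$, $\mathcal{B}_h^{-1}$ be as in the context. (i) (Residual-correction form of the parallel Schwarz method.) Let $u^n\in U(\Omega)$, let $u_\ell^{n+1}\in U(\Omega_\ell)$ ($\ell=1,\dots,N$) solve $$-(\Delta+k^2)u_\ell^{n+1}=f\ \text{ in }\Omega_\ell,$$ $$\left(\tfrac{\partial}{\partial n_\ell}-\mathrm{i}k\right)u_\ell^{n+1}=\left(\tfrac{\partial}{\partial n_\ell}-\mathrm{i}k\right)u^n\ \text{ on }\partial\Omega_\ell\setminus\partial\Omega,$$ $$\left(\tfrac{\partial}{\partial n_\ell}-\mathrm{i}k\right)u_\ell^{n+1}=g\ \text{ on }\partial\Omega_\ell\cap\partial\Omega,$$ and let $u^{n+1}:=\sum_\ell\chi_\ell u_\ell^{n+1}$. Then the corrections $\delta_\ell^n:=u_\ell^{n+1}-u^n|_{\overline{\Omega_\ell}}$ satisfy $u^{n+1}=u^n+\sum_\ell\chi_\ell\delta_\ell^n$ and, for all $v_\ell\in H^1(\Omega_\ell)$, $$a_\ell(\delta_\ell^n,v_\ell)=\int_{\Omega_\ell}f\,\overline{v_\ell}+\int_{\partial\Omega_\ell\cap\partial\Omega}g\,\overline{v_\ell}+\int_{\Omega_\ell}(\Delta+k^2)u^n\,\overline{v_\ell}-\int_{\partial\Omega_\ell\cap\partial\Omega}\left(\tfrac{\partial}{\partial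 n_\ell}-\mathrm{i}k\right)u^n\,\overline{v_\ell}.$$ Moreover, for every $v_{h,\ell}\in\mathcal{V}^h_\ell$, $$\int_\Omega(\Delta+k^2)u^n\,\overline{\mathcal{R}_{h,\ell}^\top v_{h,\ell}}-\int_{\partial\Omega}\left(\tfrac{\partial}{\partial n}-\mathrm{i}k\right)u^n\,\overline{\mathcal{R}_{h,\ell}^\top v_{h,\ell}}=-a(u^n,\mathcal{R}_{h,\ell}^\top v_{h,\ell}).$$ (ii) (The finite element analogue is ORAS.) Let $u_h^n\in\mathcal{V}^h$, let $\delta_{h,\ell}^n\in\mathcal{V}^h_\ell$ ($\ell=1,\dots,N$) be defined by $$a_\ell(\delta_{h,\ell}^n,v_{h,\ell})=(\mathcal{R}_{h,\ell}F_h)(v_{h,\ell})-a(u_h^n,\mathcal{R}_{h,\ell}^\top v_{h,\ell})\quad\text{for all }v_{h,\ell}\in\mathcal{V}^h_\ell,$$ and let $$u_h^{n+1}:=u_h^n+\sum_\ell\widetilde{\mathcal{R}}_{h,\ell}^\top\delta_{h,\ell}^n.$$ Then $\delta_{h,\ell}^n=\mathcal{A}_{h,\ell}^{-1}\mathcal{R}_{h,\ell}(F_h-\mathcal{A}_hu_h^n)$ for each $\ell$, and $u_h^{n+1}$ is exactly the next iterate of the Richardson iteration preconditioned by $\mathcal{B}_h^{-1}$: $$u_h^{n+1}=u_h^n+\mathcal{B}_h^{-1}(F_h-\mathcal{A}_hu_h^n).$$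
   Context: Problem: $\Omega\subset\mathbb{R}^d$ ($d=2,3$) is a bounded Lipschitz polyhedral domain, $k>0$ is a constant, $f\in L^2(\Omega)$, $g\in L^2(\partial\Omega)$. The interior impedance problem is $-(\Delta+k^2)u=f$ in $\Omega$, $(\partial/\partial n-\mathrm{i}k)u=g$ on $\partial\Omega$, with $\partial/\partial n$ the outward normal derivative. Its weak form is: find $u\in H^1(\Omega)$ with $a(u,v)=F(v)$ for all $v\in H^1(\Omega)$, where $$a(u,v)=\int_\Omega(\nabla u\cdot\nabla\overline v-k^2u\overline v)-\mathrm{i}k\int_{\partial\Omega}u\overline v,\qquad F(v)=\int_\Omega f\overline v+\int_{\partial\Omega}g\overline v.$$ Subdomains: $\{\Omega_\ell\}_{\ell=1}^N$ are Lipschitz polyhedral subdomains forming an overlapping cover of $\Omega$, with outward normal derivatives $\partial/\partial n_\ell$ on $\partial\Omega_\ell$. The functions $\{\chi_\ell\}_{\ell=1}^N$ form a partition of unity: $\operatorname{supp}\chi_\ell\subset\overline{\Omega_\ell}$, $0\le\chi_\ell\le1$ on $\overline{\Omega_\ell}$, and $\sum_\ell\chi_\ell(x)=1$ for all $x\in\overline\Omega$. In a sum $\sum_\ell\chi_\ell w_\ell$ with $w_\ell$ defined on $\Omega_\ell$, each term is extended by zero outside $\Omega_\ell$. The local form, for $u,v\in H^1(\Omega_\ell)$, is $$a_\ell(u,v)=\int_{\Omega_\ell}(\nabla u\cdot\nabla\overline v-k^2u\overline v)-\mathrm{i}k\int_{\partial\Omega_\ell}u\overline v.$$ Function space: for a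 domain $D$ (here $D=\Omega$ or $D=\Omega_\ell$), $U(D)=\{v\in H^1(D):\Delta v\in L^2(D),\ \partial v/\partial n\in L^2(\partial D)\}$. Functions in $U(\Omega)$ have impedance traces $(\partial/\partial n_\ell-\mathrm{i}k)v\in L^2(\partial\Omega_\ell)$ (a known fact that may be used). Finite elements: $\mathcal{V}^h\subset H^1(\Omega)$ is a nodal finite element space of continuous piecewise polynomials of total degree $\le p$ on a conforming mesh $\mathcal{T}^h$ of $\Omega$. Its functions are uniquely determined by their values at nodes $\{x_j:j\in\mathcal{I}\}\subset\overline\Omega$. Each $\overline{\Omega_\ell}$ is a union of mesh elements. The local space is $\mathcal{V}^h_\ell=\{v_h|_{\overline{\Omega_\ell}}:v_h\in\mathcal{V}^h\}$, with nodes $\{x_j:j\in\mathcal{I}_\ell\}$, where $\mathcal{I}_\ell\subset\mathcal{I}$ indexes the nodes lying in $\overline{\Omega_\ell}$. Primes denote the space of antilinear functionals. Operators: - $\mathcal{A}_h:\mathcal{V}^h\to(\mathcal{V}^h)'$, $(\mathcal{A}_hu_h)(v_h)=a(u_h,v_h)$; $F_h\in(\mathcal{V}^h)'$, $F_h(v_h)=F(v_h)$. - $\mathcal{A}_{h,\ell}:\mathcal{V}^h_\ell\to(\mathcal{V}^h_\ell)'$, $(\mathcal{A}_{h,\ell}u_{h,\ell})(v_{h,\ell})=a_\ell(u_{h,\ell},v_{h,\ell})$, assumed invertible for each $\ell$. - Nodewise extension $\mathcal{R}_{h,\ell}^\top:\mathcal{V}^h_\ell\to\mathcal{V}^h$: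 $(\mathcal{R}_{h,\ell}^\top v_{h,\ell})(x_j)=v_{h,\ell}(x_j)$ if $j\in\mathcal{I}_\ell$, and $0$ for all other nodes. - Weighted extension $\widetilde{\mathcal{R}}_{h,\ell}^\top:\mathcal{V}^h_\ell\to\mathcal{V}^h$: $\widetilde{\mathcal{R}}_{h,\ell}^\top v_{h,\ell}=\mathcal{R}_{h,\ell}^\top(\chi_\ell v_{h,\ell})$, understood nodewise, i.e. the element of $\mathcal{V}^h$ with value $\chi_\ell(x_j)v_{h,\ell}(x_j)$ at $x_j$ for $j\in\mathcal{I}_\ell$ and $0$ at all other nodes. - Restriction $\mathcal{R}_{h,\ell}:(\mathcal{V}^h)'\to(\mathcal{V}^h_\ell)'$ by duality: $(\mathcal{R}_{h,\ell}G_h)(v_{h,\ell})=G_h(\mathcal{R}_{h,\ell}^\top v_{h,\ell})$. - ORAS (Optimized Restricted Additive Schwarz) preconditioner $\mathcal{B}_h^{-1}:(\mathcal{V}^h)'\to\mathcal{V}^h$: $\mathcal{B}_h^{-1}=\sum_\ell\widetilde{\mathcal{R}}_{h,\ell}^\top\mathcal{A}_{h,\ell}^{-1}\mathcal{R}_{h,\ell}$ (the symbol $\mathcal{B}_h^{-1}$ is just notation for this sum). *)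

theory Defs
  imports "HOL-Analysis.Analysis"
begin

text \<open>
  Functions on a set \<open>D\<close> are total functions on \<open>\<real>\<^sup>d\<close> of which only the values on \<open>D\<close> matter, so
  restriction to a subdomain is silent.  Finite element functions, for which genuine equality
  of functions is needed, are normalised to vanish off the closed set on which they live.
\<close>

section \<open>Domains\<close>

text \<open>Near each boundary point, \<open>D\<close> is the subgraph of a Lipschitz function over the hyperplane
  orthogonal to some unit vector \<open>e\<close>.\<close>

definition lipschitz_boundary :: "(real^'d) set \<Rightarrow> bool" where
  "lipschitz_boundary D \<longleftrightarrow>
     (\<forall>x\<in>frontier D. \<exists>U e (\<psi> :: real^'d \<Rightarrow> real) L.
        open U \<and> x \<in> U \<and> norm e = 1 \<and> L-lipschitz_on UNIV \<psi> \<and>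
        D \<inter> U = {y\<in>U. y \<bullet> e < \<psi> (y - (y \<bullet> e) *\<^sub>R e)})"

definition polyhedral :: "(real^'d) set \<Rightarrow> bool" where
  "polyhedral D \<longleftrightarrow> (\<exists>\<P>. finite \<P> \<and> (\<forall>P\<in>\<P>. polytope P) \<and> closure D = \<Union>\<P>)"

definition lipschitz_polyhedral_domain :: "(real^'d) set \<Rightarrow> bool" where
  "lipschitz_polyhedral_domain D \<longleftrightarrow>
     open D \<and> connected D \<and> D \<noteq> {} \<and> bounded D \<and> lipschitz_boundary D \<and> polyhedral D"

section \<open>Surface measure\<close>

text \<open>Hausdorff measure of dimension \<open>s \<ge> 1\<close>, normalised so that it agrees with the classical
  \<open>s\<close>-dimensional surface measure.\<close>

definition hausdorff_content :: "nat \<Rightarrow> real \<Rightarrow> 'a::metric_space set \<Rightarrow> ennreal" where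
  "hausdorff_content s \<delta> A =
     (INF C \<in> {C :: nat \<Rightarrow> 'a set. A \<subseteq> (\<Union>i. C i) \<and> (\<forall>i. bounded (C i) \<and> diameter (C i) \<le> \<delta>)}.
        \<Sum>i. ennreal (unit_ball_vol (real s) * (diameter (C i) / 2) ^ s))"

definition hausdorff_measure :: "nat \<Rightarrow> 'a::metric_space measure" where
  "hausdorff_measure s =
     measure_of UNIV (sets borel) (\<lambda>A. SUP \<delta>\<in>{0<..}. hausdorff_content s \<delta> A)"

definition surf :: "(real^'d) set \<Rightarrow> (real^'d) measure" where
  "surf S = restrict_space (hausdorff_measure (CARD('d) - 1)) S"

section \<open>Lebesgue and Sobolev spaces\<close>

definition l2sq :: "'a measure \<Rightarrow> ('a \<Rightarrow> complex) \<Rightarrow> ennreal" where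
  "l2sq M u = (\<integral>\<^sup>+x. ennreal ((norm (u x))\<^sup>2) \<partial>M)"

definition L2 :: "'a measure \<Rightarrow> ('a \<Rightarrow> complex) set" where
  "L2 M = {u \<in> borel_measurable M. l2sq M u < \<infinity>}"

definition partial :: "'d \<Rightarrow> (real^'d \<Rightarrow> real) \<Rightarrow> real^'d \<Rightarrow> real" where
  "partial i \<phi> x = frechet_derivative \<phi> (at x) (axis i 1)"

fun C_k :: "nat \<Rightarrow> (real^'d \<Rightarrow> real) \<Rightarrow> bool" where
  "C_k 0 \<phi> \<longleftrightarrow> continuous_on UNIV \<phi>"
| "C_k (Suc n) \<phi> \<longleftrightarrow> (\<forall>x. \<phi> differentiable (at x)) \<and> (\<forall>i. C_k n (partial i \<phi>))"

definition test_functions :: "(real^'d) set \<Rightarrow> (real^'d \<Rightarrow> real) set" where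
  "test_functions D =
     {\<phi>. (\<forall>n. C_k n \<phi>) \<and> compact (closure {x. \<phi> x \<noteq> 0}) \<and> closure {x. \<phi> x \<noteq> 0} \<subseteq> D}"

definition has_weak_gradient ::
    "(real^'d) set \<Rightarrow> (real^'d \<Rightarrow> complex) \<Rightarrow> (real^'d \<Rightarrow> complex^'d) \<Rightarrow> bool" where
  "has_weak_gradient D u G \<longleftrightarrow>
     (\<forall>i. (\<lambda>x. G x $ i) \<in> L2 (lebesgue_on D)) \<and>
     (\<forall>\<phi>\<in>test_functions D. \<forall>i.
        (LINT x|lebesgue_on D. u x * of_real (partial i \<phi> x)) =
        - (LINT x|lebesgue_on D. G x $ i * of_real (\<phi> x)))"

definition H1 :: "(real^'d) set \<Rightarrow> (real^'d \<Rightarrow> complex) set" where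
  "H1 D = {u \<in> L2 (lebesgue_on D). \<exists>G. has_weak_gradient D u G}"

definition wgrad :: "(real^'d) set \<Rightarrow> (real^'d \<Rightarrow> complex) \<Rightarrow> real^'d \<Rightarrow> complex^'d" where
  "wgrad D u = (SOME G. has_weak_gradient D u G)"

definition h1sq :: "(real^'d) set \<Rightarrow> (real^'d \<Rightarrow> complex) \<Rightarrow> ennreal" where
  "h1sq D u = l2sq (lebesgue_on D) u + (\<Sum>i\<in>UNIV. l2sq (lebesgue_on D) (\<lambda>x. wgrad D u x $ i))"

definition has_weak_laplacian ::
    "(real^'d) set \<Rightarrow> (real^'d \<Rightarrow> complex) \<Rightarrow> (real^'d \<Rightarrow> complex) \<Rightarrow> bool" where
  "has_weak_laplacian D u w \<longleftrightarrow>
     w \<in> L2 (lebesgue_on D) \<and>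
     (\<forall>\<phi>\<in>test_functions D.
        (LINT x|lebesgue_on D. u x * of_real (\<Sum>i\<in>UNIV. partial i (partial i \<phi>) x)) =
        (LINT x|lebesgue_on D. w x * of_real (\<phi> x)))"

definition laplacian :: "(real^'d) set \<Rightarrow> (real^'d \<Rightarrow> complex) \<Rightarrow> real^'d \<Rightarrow> complex" where
  "laplacian D u = (SOME w. has_weak_laplacian D u w)"

section \<open>Boundary values\<close>

text \<open>\<open>t\<close> is an \<open>L\<^sup>2\<close> limit of boundary values of functions continuous up to the boundary which
  approximate \<open>u\<close> in \<open>H\<^sup>1\<close>.\<close>

definition has_trace :: "(real^'d) set \<Rightarrow> (real^'d \<Rightarrow> complex) \<Rightarrow> (real^'d \<Rightarrow> complex) \<Rightarrow> bool" where
  "has_trace D u t \<longleftrightarrow>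
     t \<in> L2 (surf (frontier D)) \<and>
     (\<exists>\<phi> :: nat \<Rightarrow> real^'d \<Rightarrow> complex.
        (\<forall>n. \<phi> n \<in> H1 D \<and> continuous_on (closure D) (\<phi> n)) \<and>
        (\<lambda>n. h1sq D (\<lambda>x. \<phi> n x - u x)) \<longlonglongrightarrow> 0 \<and>
        (\<lambda>n. l2sq (surf (frontier D)) (\<lambda>x. \<phi> n x - t x)) \<longlonglongrightarrow> 0)"

text \<open>The trace operator \<open>H\<^sup>1(D) \<rightarrow> L\<^sup>2(\<partial>D)\<close>.  By the trace theorem, on a bounded Lipschitz domain
  every \<open>u \<in> H1 D\<close> satisfies \<open>has_trace D u t\<close> for some \<open>t\<close>, unique up to a null set; hence the
  properties below determine \<open>\<gamma>\<close> up to null sets.\<close>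

definition is_trace_operator ::
    "(real^'d) set \<Rightarrow> ((real^'d \<Rightarrow> complex) \<Rightarrow> real^'d \<Rightarrow> complex) \<Rightarrow> bool" where
  "is_trace_operator D \<gamma> \<longleftrightarrow>
     (\<forall>u\<in>H1 D. \<gamma> u \<in> L2 (surf (frontier D))) \<and>
     (\<forall>u\<in>H1 D. \<forall>v\<in>H1 D. AE x in surf (frontier D). \<gamma> (\<lambda>y. u y + v y) x = \<gamma> u x + \<gamma> v x) \<and>
     (\<forall>u\<in>H1 D. \<forall>c. AE x in surf (frontier D). \<gamma> (\<lambda>y. c * u y) x = c * \<gamma> u x) \<and>
     (\<forall>u\<in>H1 D. (\<exists>t. has_trace D u t) \<longrightarrow> has_trace D u (\<gamma> u))"

definition bdry_trace :: "(real^'d) set \<Rightarrow> (real^'d \<Rightarrow> complex) \<Rightarrow> real^'d \<Rightarrow> complex" where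
  "bdry_trace D = (SOME \<gamma>. is_trace_operator D \<gamma>)"

text \<open>For \<open>v \<in> H\<^sup>1(D)\<close> with \<open>\<Delta>v \<in> L\<^sup>2(D)\<close> the outward normal derivative is the functional on traces
  given by Green's identity; \<open>\<partial>v/\<partial>n \<in> L\<^sup>2(\<partial>D)\<close> means that it is represented by some \<open>h \<in> L\<^sup>2(\<partial>D)\<close>.\<close>

definition has_normal_derivative ::
    "(real^'d) set \<Rightarrow> (real^'d \<Rightarrow> complex) \<Rightarrow> (real^'d \<Rightarrow> complex) \<Rightarrow> bool" where
  "has_normal_derivative D v h \<longleftrightarrow>
     h \<in> L2 (surf (frontier D)) \<and>
     (\<forall>w\<in>H1 D.
        (LINT x|lebesgue_on D.
           (\<Sum>i\<in>UNIV. wgrad D v x $ i * cnj (wgrad D w x $ i)) + laplacian D v x * cnj (w x)) =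
        (LINT x|surf (frontier D). h x * cnj (bdry_trace D w x)))"

definition normal_derivative :: "(real^'d) set \<Rightarrow> (real^'d \<Rightarrow> complex) \<Rightarrow> real^'d \<Rightarrow> complex" where
  "normal_derivative D v = (SOME h. has_normal_derivative D v h)"

definition U_space :: "(real^'d) set \<Rightarrow> (real^'d \<Rightarrow> complex) set" where
  "U_space D =
     {v \<in> H1 D. (\<exists>w. has_weak_laplacian D v w) \<and> (\<exists>h. has_normal_derivative D v h)}"

definition impedance_trace ::
    "real \<Rightarrow> (real^'d) set \<Rightarrow> (real^'d \<Rightarrow> complex) \<Rightarrow> real^'d \<Rightarrow> complex" where
  "impedance_trace k D v x = normal_derivative D v x - \<i> * of_real k * bdry_trace D v x"

section \<open>The Helmholtz forms\<close>

definition a_form ::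
    "real \<Rightarrow> (real^'d) set \<Rightarrow> (real^'d \<Rightarrow> complex) \<Rightarrow> (real^'d \<Rightarrow> complex) \<Rightarrow> complex" where
  "a_form k D u v =
     (LINT x|lebesgue_on D.
        (\<Sum>i\<in>UNIV. wgrad D u x $ i * cnj (wgrad D v x $ i)) - (of_real k)\<^sup>2 * u x * cnj (v x))
     - \<i> * of_real k * (LINT x|surf (frontier D). bdry_trace D u x * cnj (bdry_trace D v x))"

definition F_form ::
    "(real^'d) set \<Rightarrow> (real^'d \<Rightarrow> complex) \<Rightarrow> (real^'d \<Rightarrow> complex) \<Rightarrow> (real^'d \<Rightarrow> complex) \<Rightarrow> complex" where
  "F_form D f g v =
     (LINT x|lebesgue_on D. f x * cnj (v x))
     + (LINT x|surf (frontier D). g x * cnj (bdry_trace D v x))"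

definition zero_ext :: "'a set \<Rightarrow> ('a \<Rightarrow> complex) \<Rightarrow> 'a \<Rightarrow> complex" where
  "zero_ext S w x = (if x \<in> S then w x else 0)"

section \<open>Overlapping decomposition and partition of unity\<close>

definition overlapping_cover :: "(real^'d) set \<Rightarrow> nat \<Rightarrow> (nat \<Rightarrow> (real^'d) set) \<Rightarrow> bool" where
  "overlapping_cover \<Omega> N \<Omega>s \<longleftrightarrow>
     (\<forall>l\<in>{1..N}. lipschitz_polyhedral_domain (\<Omega>s l)) \<and> (\<Union>l\<in>{1..N}. \<Omega>s l) = \<Omega>"

definition partition_of_unity ::
    "(real^'d) set \<Rightarrow> nat \<Rightarrow> (nat \<Rightarrow> (real^'d) set) \<Rightarrow> (nat \<Rightarrow> real^'d \<Rightarrow> real) \<Rightarrow> bool" where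
  "partition_of_unity \<Omega> N \<Omega>s pu \<longleftrightarrow>
     (\<forall>l\<in>{1..N}. closure {x. pu l x \<noteq> 0} \<subseteq> closure (\<Omega>s l) \<and>
                  (\<forall>x\<in>closure (\<Omega>s l). 0 \<le> pu l x \<and> pu l x \<le> 1)) \<and>
     (\<forall>x\<in>closure \<Omega>. (\<Sum>l=1..N. pu l x) = 1)"

section \<open>Finite element spaces\<close>

definition conforming_mesh :: "(real^'d) set \<Rightarrow> (real^'d) set set \<Rightarrow> bool" where
  "conforming_mesh \<Omega> \<T> \<longleftrightarrow>
     finite \<T> \<and> (\<forall>K\<in>\<T>. polytope K \<and> interior K \<noteq> {}) \<and> \<Union>\<T> = closure \<Omega> \<and>
     (\<forall>K\<in>\<T>. \<forall>K'\<in>\<T>. (K \<inter> K') face_of K \<and> (K \<inter> K') face_of K')"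

definition polynomials :: "nat \<Rightarrow> (real^'d \<Rightarrow> complex) set" where
  "polynomials p =
     {q. \<exists>c. \<forall>x. q x = (\<Sum>\<alpha> | (\<Sum>i\<in>UNIV. \<alpha> i) \<le> p. c \<alpha> * of_real (\<Prod>i\<in>UNIV. (x $ i) ^ \<alpha> i))}"

definition piecewise_polynomials ::
    "(real^'d) set \<Rightarrow> (real^'d) set set \<Rightarrow> nat \<Rightarrow> (real^'d \<Rightarrow> complex) set" where
  "piecewise_polynomials \<Omega> \<T> p =
     {v. continuous_on (closure \<Omega>) v \<and> (\<forall>x. x \<notin> closure \<Omega> \<longrightarrow> v x = 0) \<and>
         (\<forall>K\<in>\<T>. \<exists>q\<in>polynomials p. \<forall>x\<in>K. v x = q x)}"

definition complex_subspace :: "('a \<Rightarrow> complex) set \<Rightarrow> bool" where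
  "complex_subspace V \<longleftrightarrow>
     (\<lambda>x. 0) \<in> V \<and> (\<forall>u\<in>V. \<forall>v\<in>V. (\<lambda>x. u x + v x) \<in> V) \<and> (\<forall>c. \<forall>u\<in>V. (\<lambda>x. c * u x) \<in> V)"

definition nodal_space :: "('a \<Rightarrow> complex) set \<Rightarrow> 'j set \<Rightarrow> ('j \<Rightarrow> 'a) \<Rightarrow> bool" where
  "nodal_space V I xn \<longleftrightarrow> (\<forall>c. \<exists>!v. v \<in> V \<and> (\<forall>j\<in>I. v (xn j) = c j))"

definition fe_space ::
    "(real^'d) set \<Rightarrow> (real^'d) set set \<Rightarrow> nat \<Rightarrow> (real^'d \<Rightarrow> complex) set \<Rightarrow>
     'j set \<Rightarrow> ('j \<Rightarrow> real^'d) \<Rightarrow> bool" where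
  "fe_space \<Omega> \<T> p V I xn \<longleftrightarrow>
     conforming_mesh \<Omega> \<T> \<and> complex_subspace V \<and> V \<subseteq> piecewise_polynomials \<Omega> \<T> p \<and> V \<subseteq> H1 \<Omega> \<and>
     finite I \<and> xn ` I \<subseteq> closure \<Omega> \<and> nodal_space V I xn"

definition local_space :: "('a \<Rightarrow> complex) set \<Rightarrow> 'a set \<Rightarrow> ('a \<Rightarrow> complex) set" where
  "local_space V S = zero_ext S ` V"

definition local_nodes :: "'j set \<Rightarrow> ('j \<Rightarrow> 'a) \<Rightarrow> 'a set \<Rightarrow> 'j set" where
  "local_nodes I xn S = {j \<in> I. xn j \<in> S}"

section \<open>Discrete operators\<close>

text \<open>Antilinear functionals on \<open>V\<close>, normalised to be \<open>0\<close> outside \<open>V\<close>.\<close>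

definition antidual :: "('a \<Rightarrow> complex) set \<Rightarrow> (('a \<Rightarrow> complex) \<Rightarrow> complex) set" where
  "antidual V =
     {G. (\<forall>u\<in>V. \<forall>v\<in>V. G (\<lambda>x. u x + v x) = G u + G v) \<and>
         (\<forall>c. \<forall>u\<in>V. G (\<lambda>x. c * u x) = cnj c * G u) \<and> (\<forall>v. v \<notin> V \<longrightarrow> G v = 0)}"

definition functional_on ::
    "('a \<Rightarrow> complex) set \<Rightarrow> (('a \<Rightarrow> complex) \<Rightarrow> complex) \<Rightarrow> ('a \<Rightarrow> complex) \<Rightarrow> complex" where
  "functional_on V G v = (if v \<in> V then G v else 0)"

definition A_op ::
    "real \<Rightarrow> (real^'d) set \<Rightarrow> (real^'d \<Rightarrow> complex) set \<Rightarrow> (real^'d \<Rightarrow> complex) \<Rightarrow>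
     (real^'d \<Rightarrow> complex) \<Rightarrow> complex" where
  "A_op k D V u = functional_on V (a_form k D u)"

definition A_inv ::
    "real \<Rightarrow> (real^'d) set \<Rightarrow> (real^'d \<Rightarrow> complex) set \<Rightarrow> ((real^'d \<Rightarrow> complex) \<Rightarrow> complex) \<Rightarrow>
     real^'d \<Rightarrow> complex" where
  "A_inv k D V = inv_into V (A_op k D V)"

text \<open>In the next three operators \<open>S\<close> is the closure of the subdomain.\<close>

definition node_ext ::
    "('a \<Rightarrow> complex) set \<Rightarrow> 'j set \<Rightarrow> ('j \<Rightarrow> 'a) \<Rightarrow> 'a set \<Rightarrow> ('a \<Rightarrow> complex) \<Rightarrow> 'a \<Rightarrow> complex" where
  "node_ext V I xn S v =
     (THE w. w \<in> V \<and> (\<forall>j\<in>I. w (xn j) = (if j \<in> local_nodes I xn S then v (xn j) else 0)))"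

definition weighted_ext ::
    "('a \<Rightarrow> complex) set \<Rightarrow> 'j set \<Rightarrow> ('j \<Rightarrow> 'a) \<Rightarrow> 'a set \<Rightarrow> ('a \<Rightarrow> real) \<Rightarrow> ('a \<Rightarrow> complex) \<Rightarrow>
     'a \<Rightarrow> complex" where
  "weighted_ext V I xn S pu v = node_ext V I xn S (\<lambda>x. of_real (pu x) * v x)"

definition restrict_op ::
    "('a \<Rightarrow> complex) set \<Rightarrow> 'j set \<Rightarrow> ('j \<Rightarrow> 'a) \<Rightarrow> 'a set \<Rightarrow> (('a \<Rightarrow> complex) \<Rightarrow> complex) \<Rightarrow>
     ('a \<Rightarrow> complex) \<Rightarrow> complex" where
  "restrict_op V I xn S G = functional_on (local_space V S) (\<lambda>v. G (node_ext V I xn S v))"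

definition oras ::
    "real \<Rightarrow> nat \<Rightarrow> (nat \<Rightarrow> (real^'d) set) \<Rightarrow> (nat \<Rightarrow> real^'d \<Rightarrow> real) \<Rightarrow>
     (real^'d \<Rightarrow> complex) set \<Rightarrow> 'j set \<Rightarrow> ('j \<Rightarrow> real^'d) \<Rightarrow>
     ((real^'d \<Rightarrow> complex) \<Rightarrow> complex) \<Rightarrow> real^'d \<Rightarrow> complex" where
  "oras k N \<Omega>s pu V I xn G x =
     (\<Sum>l=1..N. weighted_ext V I xn (closure (\<Omega>s l)) (pu l)
        (A_inv k (\<Omega>s l) (local_space V (closure (\<Omega>s l)))
          (restrict_op V I xn (closure (\<Omega>s l)) G)) x)"

end

theory Submission
  imports Defs "HOL-Library.Function_Algebras"
begin

text \<open>
  The two parts of the theorem are of a different nature.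

  Part (i) is Green's identity.  For \<open>v \<in> U(D)\<close> and \<open>w \<in> H\<^sup>1(D)\<close>, with conjugate \<open>w\<^sup>*\<close>, it reads
  \<open>a(v, w) = \<integral>\<^bsub>\<partial>D\<^esub> (\<partial>/\<partial>n - ik)v w\<^sup>* - \<integral>\<^bsub>D\<^esub> (\<Delta> + k\<^sup>2)v w\<^sup>*\<close> (\<open>a_form_green\<close>).  On \<open>\<Omega>\<close> this is the last claim.
  On a subdomain, subtracting the identity for the previous iterate from the one for the local
  solution and inserting the equation and the boundary conditions gives the equation of the
  correction (\<open>a_form_correction\<close>).  The formula for the glued iterate says that the functions \<open>\<chi>\<^sub>l\<close>,
  extended by zero from the open subdomains, sum to one away from the subdomain boundaries; these are
  null sets because they are locally Lipschitz graphs (\<open>glued_correction_AE\<close>).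

  The work lies in the objects that Green's identity is about.  Weak gradients and Laplacians are
  chosen among all admissible ones, and the choice is harmless only because it is unique almost
  everywhere; this is the fundamental lemma of the calculus of variations, for which smooth bump
  functions supported in boxes are constructed from \<open>e\<^bsup>-1/t\<^esup>\<close>.  The trace operator is likewise chosen among
  all maps with certain properties, and one has to know that there is such a map: the properties
  describe a linear selection of a linear relation, and a Hamel basis provides one
  (\<open>is_trace_operator_bdry_trace\<close>).

  Part (ii) is algebra: the local equation says that \<open>A\<^sub>h\<^sub>,\<^sub>l \<delta>\<^sub>l\<close> and \<open>R\<^sub>h\<^sub>,\<^sub>l (F\<^sub>h - A\<^sub>h u)\<close> agree as functionals on the
  local space, and \<open>A\<^sub>h\<^sub>,\<^sub>l\<close> is injective (\<open>A_inv_eq\<close>).\<close>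

section \<open>Smooth bump functions\<close>

text \<open>
  The test functions of a domain are smooth in the sense of iterated partial derivatives.  Enough of
  them arise as products \<open>\<Prod>\<^sub>j F\<^sub>j(x\<^sub>j)\<close> of functions of one variable, because a partial derivative of
  such a product is again such a product, with one factor differentiated.  Smoothness therefore only
  has to be checked on the real line.\<close>

fun smooth_upto :: "nat \<Rightarrow> (real \<Rightarrow> real) \<Rightarrow> bool" where
  "smooth_upto 0 f \<longleftrightarrow> continuous_on UNIV f"
| "smooth_upto (Suc n) f \<longleftrightarrow>
     (\<exists>f'. (\<forall>t. (f has_real_derivative f' t) (at t)) \<and> smooth_upto n f')"

lemma smooth_upto_Suc_D: "smooth_upto (Suc n) f \<Longrightarrow> smooth_upto n f"
proof (induction n arbitrary: f)
  case 0
  then show ?case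
    by (auto intro: DERIV_continuous_on has_field_derivative_at_within)
next
  case (Suc n)
  then obtain f' where "\<forall>t. (f has_real_derivative f' t) (at t)" "smooth_upto (Suc n) f'"
    by auto
  then show ?case using Suc.IH[of f'] by auto
qed

lemma smooth_upto_add:
  "smooth_upto n f \<Longrightarrow> smooth_upto n g \<Longrightarrow> smooth_upto n (\<lambda>t. f t + g t)"
proof (induction n arbitrary: f g)
  case 0
  then show ?case by (auto intro: continuous_intros)
next
  case (Suc n)
  then obtain f' g' where "\<forall>t. (f has_real_derivative f' t) (at t)" "smooth_upto n f'"
    "\<forall>t. (g has_real_derivative g' t) (at t)" "smooth_upto n g'"
    by auto
  then show ?case
    using Suc.IH[of f' g'] by (auto intro!: exI[of _ "\<lambda>t. f' t + g' t"] derivative_intros)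
qed

lemma smooth_upto_mult:
  "smooth_upto n f \<Longrightarrow> smooth_upto n g \<Longrightarrow> smooth_upto n (\<lambda>t. f t * g t)"
proof (induction n arbitrary: f g)
  case 0
  then show ?case by (auto intro: continuous_intros)
next
  case (Suc n)
  then obtain f' g' where *: "\<forall>t. (f has_real_derivative f' t) (at t)" "smooth_upto n f'"
    "\<forall>t. (g has_real_derivative g' t) (at t)" "smooth_upto n g'"
    by auto
  have "smooth_upto n (\<lambda>t. f' t * g t + f t * g' t)"
    using Suc * smooth_upto_Suc_D by (intro smooth_upto_add Suc.IH) blast+
  moreover have "((\<lambda>t. f t * g t) has_real_derivative f' t * g t + f t * g' t) (at t)" for t
    using * by (auto intro!: derivative_eq_intros)
  ultimately show ?case
    unfolding smooth_upto.simps by (intro exI[of _ "\<lambda>t. f' t * g t + f t * g' t"]) blast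
qed

lemma smooth_upto_affine:
  "smooth_upto n f \<Longrightarrow> smooth_upto n (\<lambda>t. f (c * t + d))"
proof (induction n arbitrary: f)
  case 0
  then show ?case
    by (auto intro!: continuous_intros continuous_on_compose2[of UNIV f])
next
  case (Suc n)
  then obtain f' where *: "\<And>t. (f has_real_derivative f' t) (at t)" "smooth_upto n f'"
    by auto
  have const: "smooth_upto m (\<lambda>t. a)" for m a
    by (induction m arbitrary: a) (auto intro!: exI[of _ "\<lambda>t. 0"])
  have "smooth_upto n (\<lambda>t. f' (c * t + d) * c)"
    using Suc.IH[OF *(2)] const by (intro smooth_upto_mult)
  moreover have "((\<lambda>t. f (c * t + d)) has_real_derivative f' (c * t + d) * c) (at t)" for t
    by (rule DERIV_chain'[where f="\<lambda>t. c * t + d" and g=f]) (auto intro!: derivative_eq_intros *)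
  ultimately show ?case
    unfolding smooth_upto.simps by (intro exI[of _ "\<lambda>t. f' (c * t + d) * c"]) blast
qed

text \<open>
  The functions \<open>P(1/t) e\<^bsup>-1/t\<^esup>\<close>, continued by \<open>0\<close> to \<open>t \<le> 0\<close>.  Admitting all polynomials \<open>P\<close> makes the
  family closed under differentiation, so that smoothness follows from a single derivative
  computation.\<close>

definition flat :: "real poly \<Rightarrow> real \<Rightarrow> real" where
  "flat P t = (if t > 0 then poly P (1 / t) * exp (- (1 / t)) else 0)"

lemma poly_times_exp_tendsto_0: "((\<lambda>s::real. poly P s * exp (- s)) \<longlongrightarrow> 0) at_top"
proof -
  have "((\<lambda>s::real. \<Sum>i\<le>degree P. coeff P i * (s ^ i / exp s)) \<longlongrightarrow> 0) at_top"
    by (intro tendsto_null_sum tendsto_mult_right_zero tendsto_power_div_exp_0)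
  moreover have "(\<Sum>i\<le>degree P. coeff P i * (s ^ i / exp s)) = poly P s * exp (- s)" for s :: real
    by (simp add: poly_altdef exp_minus sum_distrib_right divide_inverse mult.assoc)
  ultimately show ?thesis by simp
qed

lemma flat_at_right: "(flat P \<longlongrightarrow> 0) (at_right 0)"
proof -
  have "((\<lambda>t::real. poly P (inverse t) * exp (- inverse t)) \<longlongrightarrow> 0) (at_right 0)"
    by (rule filterlim_compose[OF poly_times_exp_tendsto_0 filterlim_inverse_at_top_right])
  then show ?thesis
    by (rule Lim_transform_eventually)
       (auto simp: flat_def eventually_at_right_field inverse_eq_divide intro!: exI[of _ 1])
qed

text \<open>
  Away from \<open>0\<close> this is the product rule.  At \<open>0\<close> the difference quotient of the function for \<open>P\<close> is the
  function for \<open>X P\<close>, which tends to \<open>0\<close> since exponentials beat polynomials.\<close>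

lemma flat_has_derivative:
  "(flat P has_real_derivative flat ([:0, 0, 1:] * (P - pderiv P)) t) (at t)"
proof -
  consider "t > 0" | "t < 0" | "t = 0" by linarith
  then show ?thesis
  proof cases
    case 1
    have "((\<lambda>t. poly P (1 / t) * exp (- (1 / t))) has_real_derivative
        flat ([:0, 0, 1:] * (P - pderiv P)) t) (at t)"
    proof -
      have inv: "((\<lambda>t::real. 1 / t) has_real_derivative - (1 / t * (1 / t))) (at t)"
        using 1 by (auto intro!: derivative_eq_intros)
      have "((\<lambda>t. poly P (1 / t)) has_real_derivative
          poly (pderiv P) (1 / t) * - (1 / t * (1 / t))) (at t)"
        by (rule DERIV_chain'[OF inv poly_DERIV])
      moreover have "((\<lambda>t. exp (- (1 / t))) has_real_derivative
          exp (- (1 / t)) * (1 / t * (1 / t))) (at t)"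
        using DERIV_chain'[OF DERIV_minus[OF inv] DERIV_exp] by simp
      ultimately have "((\<lambda>t. poly P (1 / t) * exp (- (1 / t))) has_real_derivative
          poly (pderiv P) (1 / t) * - (1 / t * (1 / t)) * exp (- (1 / t)) +
          exp (- (1 / t)) * (1 / t * (1 / t)) * poly P (1 / t)) (at t)"
        by (rule DERIV_mult)
      also have "poly (pderiv P) (1 / t) * - (1 / t * (1 / t)) * exp (- (1 / t)) +
          exp (- (1 / t)) * (1 / t * (1 / t)) * poly P (1 / t)
        = flat ([:0, 0, 1:] * (P - pderiv P)) t"
        using 1 by (simp add: flat_def algebra_simps)
      finally show ?thesis .
    qed
    moreover have "\<forall>\<^sub>F s in nhds t. flat P s = poly P (1 / s) * exp (- (1 / s))"
      using eventually_nhds_in_open[of "{0<..}" t] 1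
      by (auto elim!: eventually_mono simp: flat_def)
    ultimately show ?thesis by (subst DERIV_cong_ev[OF refl _ refl])
  next
    case 2
    have "\<forall>\<^sub>F s in nhds t. flat P s = 0"
      using eventually_nhds_in_open[of "{..<0}" t] 2
      by (auto elim!: eventually_mono simp: flat_def)
    then have "(flat P has_real_derivative 0) (at t)"
      by (subst DERIV_cong_ev[OF refl _ refl]) auto
    then show ?thesis using 2 by (simp add: flat_def)
  next
    case 3
    have "((\<lambda>h. flat P h / h) \<longlongrightarrow> 0) (at_right 0)"
      by (rule Lim_transform_eventually[OF flat_at_right[of "[:0, 1:] * P"]])
         (auto simp: flat_def eventually_at_right_field intro!: exI[of _ 1])
    moreover have "((\<lambda>h. flat P h / h) \<longlongrightarrow> 0) (at_left 0)"
      by (rule Lim_transform_eventually[OF tendsto_const])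
         (auto simp: flat_def eventually_at_left_field intro!: exI[of _ "-1"])
    ultimately have "((\<lambda>h. flat P h / h) \<longlongrightarrow> 0) (at 0)"
      by (simp add: filterlim_split_at)
    then show ?thesis using 3 by (simp add: DERIV_def flat_def)
  qed
qed

lemma smooth_upto_flat: "smooth_upto n (flat P)"
proof (induction n arbitrary: P)
  case 0
  then show ?case
    using flat_has_derivative by (auto intro: DERIV_continuous_on has_field_derivative_at_within)
next
  case (Suc n)
  show ?case
    unfolding smooth_upto.simps using flat_has_derivative Suc
    by (intro exI[of _ "flat ([:0, 0, 1:] * (P - pderiv P))"]) blast
qed

text \<open>
  As \<open>m\<close> grows, \<open>e\<^bsup>-1/(mt)\<^esup>\<close> increases to \<open>1\<close> for each \<open>t > 0\<close>; hence these functions, supported in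
  \<open>[a, b]\<close> and with values in \<open>[0, 1]\<close>, converge pointwise to the indicator function of \<open>(a, b)\<close>.\<close>

definition bump :: "real \<Rightarrow> real \<Rightarrow> real \<Rightarrow> real \<Rightarrow> real" where
  "bump m a b t = flat 1 (m * (t - a)) * flat 1 (m * (b - t))"

lemma smooth_upto_bump: "smooth_upto n (bump m a b)"
proof -
  have "smooth_upto n (\<lambda>t. flat 1 (m * t + - m * a) * flat 1 (- m * t + m * b))"
    by (intro smooth_upto_mult smooth_upto_affine smooth_upto_flat)
  also have "(\<lambda>t. flat 1 (m * t + - m * a) * flat 1 (- m * t + m * b)) = bump m a b"
    by (auto simp: bump_def algebra_simps)
  finally show ?thesis .
qed

lemma bump_bounds: "0 \<le> bump m a b t" "bump m a b t \<le> 1"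
  by (auto simp: bump_def flat_def intro!: mult_le_one)

lemma bump_eq_0: "m \<ge> 0 \<Longrightarrow> \<not> (a < t \<and> t < b) \<Longrightarrow> bump m a b t = 0"
  by (auto simp: bump_def flat_def zero_less_mult_iff)

lemma bump_tendsto:
  "(\<lambda>m. bump (real (Suc m)) a b t) \<longlonglongrightarrow> (if a < t \<and> t < b then 1 else 0)"
proof (cases "a < t \<and> t < b")
  case True
  have *: "(\<lambda>m. flat 1 (real (Suc m) * s)) \<longlonglongrightarrow> 1" if "s > 0" for s
  proof -
    have "(\<lambda>m. exp (- ((1 / s) * (1 / real (Suc m))))) \<longlonglongrightarrow> exp (- ((1 / s) * 0))"
      by (intro tendsto_intros LIMSEQ_Suc[OF lim_const_over_n])
    then show ?thesis using that by (simp add: flat_def mult.commute)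
  qed
  show ?thesis using True tendsto_mult[OF *[of "t - a"] *[of "b - t"]] by (simp add: bump_def)
next
  case False
  then have "bump (real (Suc m)) a b t = 0" for m by (intro bump_eq_0) auto
  with False show ?thesis by auto
qed

lemma C_k_prod:
  assumes "\<And>j. smooth_upto n (F j)"
  shows "C_k n (\<lambda>x::real^'d. \<Prod>j\<in>UNIV. F j (x $ j))"
  using assms
proof (induction n arbitrary: F)
  case 0
  then have "continuous_on UNIV (\<lambda>x::real^'d. F j (x $ j))" for j
    by (auto intro: continuous_on_compose2[OF _ continuous_on_component[OF continuous_on_id]])
  then show ?case by (simp add: continuous_on_prod)
next
  case (Suc n)
  then have "\<forall>j. \<exists>f'. (\<forall>t. (F j has_real_derivative f' t) (at t)) \<and> smooth_upto n f'"
    by simp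
  from choice[OF this] obtain F' where
    F': "\<And>j t. (F j has_real_derivative F' j t) (at t)" "\<And>j. smooth_upto n (F' j)"
    by blast
  have "((\<lambda>x. F j (x $ j)) has_derivative (\<lambda>h. h $ j * F' j (x $ j))) (at x)" for j and x :: "real^'d"
    using has_derivative_compose[OF bounded_linear.has_derivative[OF bounded_linear_vec_nth has_derivative_ident]
       F'(1)[of j "x $ j", unfolded has_field_derivative_def]]
    by (simp add: mult.commute)
  then have D: "((\<lambda>x. \<Prod>j\<in>UNIV. F j (x $ j)) has_derivative
      (\<lambda>h. \<Sum>i\<in>UNIV. h $ i * F' i (x $ i) * (\<Prod>j\<in>UNIV - {i}. F j (x $ j)))) (at x)" for x :: "real^'d"
    by (rule has_derivative_prod)
  have "partial i (\<lambda>x. \<Prod>j\<in>UNIV. F j (x $ j)) = (\<lambda>x. \<Prod>j\<in>UNIV. (F(i := F' i)) j (x $ j))" for i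
  proof
    fix x :: "real^'d"
    have "partial i (\<lambda>x. \<Prod>j\<in>UNIV. F j (x $ j)) x
        = (\<Sum>l\<in>UNIV. axis i 1 $ l * F' l (x $ l) * (\<Prod>j\<in>UNIV - {l}. F j (x $ j)))"
      unfolding partial_def by (subst frechet_derivative_at[OF D, symmetric]) simp
    also have "\<dots> = (\<Sum>l\<in>UNIV. if l = i then F' l (x $ l) * (\<Prod>j\<in>UNIV - {l}. F j (x $ j)) else 0)"
      by (intro sum.cong) (auto simp: axis_def)
    also have "\<dots> = F' i (x $ i) * (\<Prod>j\<in>UNIV - {i}. F j (x $ j))"
      by simp
    also have "\<dots> = (\<Prod>j\<in>UNIV. (F(i := F' i)) j (x $ j))"
      by (subst prod.remove[of UNIV i]) (auto intro!: prod.cong)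
    finally show "partial i (\<lambda>x. \<Prod>j\<in>UNIV. F j (x $ j)) x = \<dots>" .
  qed
  moreover have "C_k n (\<lambda>x::real^'d. \<Prod>j\<in>UNIV. (F(i := F' i)) j (x $ j))" for i
    using F'(2) smooth_upto_Suc_D[OF Suc.prems] by (intro Suc.IH) simp
  moreover have "(\<lambda>x::real^'d. \<Prod>j\<in>UNIV. F j (x $ j)) differentiable at x" for x
    using D unfolding differentiable_def by blast
  ultimately show ?case
    by simp
qed

definition box_bump :: "real \<Rightarrow> real^'d \<Rightarrow> real^'d \<Rightarrow> real^'d \<Rightarrow> real" where
  "box_bump m a b x = (\<Prod>j\<in>UNIV. bump m (a $ j) (b $ j) (x $ j))"

lemma box_bump_eq_0: "m \<ge> 0 \<Longrightarrow> x \<notin> box a b \<Longrightarrow> box_bump m a b x = 0"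
  unfolding box_bump_def mem_box_cart by (auto intro!: bump_eq_0)

lemma box_bump_bounds: "0 \<le> box_bump m a b x" "box_bump m a b x \<le> 1"
  unfolding box_bump_def by (auto intro!: prod_nonneg prod_le_1 bump_bounds)

lemma box_bump_tendsto: "(\<lambda>m. box_bump (real (Suc m)) a b x) \<longlonglongrightarrow> indicator (box a b) x"
proof -
  have "(\<lambda>m. box_bump (real (Suc m)) a b x) \<longlonglongrightarrow>
     (\<Prod>j\<in>UNIV. if a $ j < x $ j \<and> x $ j < b $ j then 1 else 0)"
    unfolding box_bump_def by (intro tendsto_prod bump_tendsto)
  also have "(\<Prod>j\<in>UNIV. if a $ j < x $ j \<and> x $ j < b $ j then 1 else 0) = (indicator (box a b) x :: real)"
    by (auto simp: indicator_def mem_box_cart)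
  finally show ?thesis .
qed

lemma C_k_box_bump: "C_k n (box_bump m a b)"
  using C_k_prod[of n "\<lambda>j. bump m (a $ j) (b $ j)"] smooth_upto_bump
  by (simp add: box_bump_def[abs_def])

lemma box_bump_test_function:
  assumes "m \<ge> 0" "cbox a b \<subseteq> D"
  shows "box_bump m a b \<in> test_functions D"
proof -
  have "{x. box_bump m a b x \<noteq> 0} \<subseteq> cbox a b"
    using box_bump_eq_0[OF assms(1), of _ a b] box_subset_cbox by blast
  then have *: "closure {x. box_bump m a b x \<noteq> 0} \<subseteq> cbox a b"
    by (rule closure_minimal[OF _ closed_cbox])
  then have "compact (closure {x. box_bump m a b x \<noteq> 0})"
    using compact_cbox[of a b] by (metis closed_closure compact_Int_closed inf.absorb_iff2)
  then show ?thesis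
    using * assms(2) C_k_box_bump unfolding test_functions_def by blast
qed

section \<open>Square-integrable functions\<close>

lemma L2_measurable [measurable_dest]: "u \<in> L2 M \<Longrightarrow> u \<in> borel_measurable M"
  by (simp add: L2_def)

lemma l2sq_cong_AE: "AE x in M. u x = v x \<Longrightarrow> l2sq M u = l2sq M v"
  unfolding l2sq_def by (intro nn_integral_cong_AE) auto

lemma l2sq_zero [simp]: "l2sq M (\<lambda>x. 0) = 0"
  by (simp add: l2sq_def)

lemma l2sq_scale:
  "u \<in> borel_measurable M \<Longrightarrow> l2sq M (\<lambda>x. c * u x) = ennreal ((norm c)\<^sup>2) * l2sq M u"
  unfolding l2sq_def by (simp add: norm_mult power_mult_distrib ennreal_mult nn_integral_cmult)

lemma l2sq_add_le:
  assumes [measurable]: "u \<in> borel_measurable M" "v \<in> borel_measurable M"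
  shows "l2sq M (\<lambda>x. u x + v x) \<le> 2 * (l2sq M u + l2sq M v)"
proof -
  have le: "(norm (a + b))\<^sup>2 \<le> 2 * ((norm a)\<^sup>2 + (norm b)\<^sup>2)" for a b :: complex
  proof -
    have "(norm (a + b))\<^sup>2 \<le> (norm a + norm b)\<^sup>2"
      by (intro power_mono norm_triangle_ineq) auto
    also have "\<dots> \<le> 2 * ((norm a)\<^sup>2 + (norm b)\<^sup>2)"
      using sum_squares_bound[of "norm a" "norm b"] by (simp add: power2_sum)
    finally show ?thesis .
  qed
  have "l2sq M (\<lambda>x. u x + v x)
      \<le> (\<integral>\<^sup>+x. 2 * (ennreal ((norm (u x))\<^sup>2) + ennreal ((norm (v x))\<^sup>2)) \<partial>M)"
    unfolding l2sq_def
  proof (intro nn_integral_mono)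
    fix x
    have "ennreal ((norm (u x + v x))\<^sup>2) \<le> ennreal (2 * ((norm (u x))\<^sup>2 + (norm (v x))\<^sup>2))"
      by (rule ennreal_leI[OF le])
    then show "ennreal ((norm (u x + v x))\<^sup>2)
        \<le> 2 * (ennreal ((norm (u x))\<^sup>2) + ennreal ((norm (v x))\<^sup>2))"
      by (simp add: ennreal_mult)
  qed
  also have "\<dots> = 2 * (l2sq M u + l2sq M v)"
    unfolding l2sq_def by (simp add: nn_integral_cmult nn_integral_add)
  finally show ?thesis .
qed

lemma L2_zero [simp]: "(\<lambda>x. 0) \<in> L2 M"
  by (simp add: L2_def)

lemma L2_scale: "u \<in> L2 M \<Longrightarrow> (\<lambda>x. c * u x) \<in> L2 M"
  by (auto simp: L2_def l2sq_scale ennreal_mult_less_top)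

lemma L2_add: "u \<in> L2 M \<Longrightarrow> v \<in> L2 M \<Longrightarrow> (\<lambda>x. u x + v x) \<in> L2 M"
  by (auto simp: L2_def ennreal_mult_less_top intro: le_less_trans[OF l2sq_add_le])

lemma L2_diff: "u \<in> L2 M \<Longrightarrow> v \<in> L2 M \<Longrightarrow> (\<lambda>x. u x - v x) \<in> L2 M"
  using L2_add[OF _ L2_scale[of v M "-1"], of u] by simp

lemma L2_cnj: "u \<in> L2 M \<Longrightarrow> (\<lambda>x. cnj (u x)) \<in> L2 M"
  unfolding L2_def l2sq_def
  by (auto intro: borel_measurable_continuous_on[OF continuous_on_cnj[OF continuous_on_id]])

lemma integrable_L2_mult:
  assumes "u \<in> L2 M" "v \<in> L2 M"
  shows "integrable M (\<lambda>x. u x * v x)"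
proof -
  have sq: "integrable M (\<lambda>x. (norm (w x))\<^sup>2)" if "w \<in> L2 M" for w :: "'a \<Rightarrow> complex"
    using that by (intro integrableI_nonneg) (auto simp: L2_def l2sq_def)
  have [measurable]: "u \<in> borel_measurable M" "v \<in> borel_measurable M"
    using assms by (auto simp: L2_def)
  show ?thesis
  proof (rule Bochner_Integration.integrable_bound)
    show "integrable M (\<lambda>x. (norm (u x))\<^sup>2 + (norm (v x))\<^sup>2)"
      by (intro Bochner_Integration.integrable_add sq assms)
    have "norm (u x) * norm (v x) \<le> (norm (u x))\<^sup>2 + (norm (v x))\<^sup>2" for x
    proof -
      have "0 \<le> norm (u x) * norm (v x)"
        by simp
      then show ?thesis
        using sum_squares_bound[of "norm (u x)" "norm (v x)"] by linarith
    qed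
    then show "AE x in M. norm (u x * v x) \<le> norm ((norm (u x))\<^sup>2 + (norm (v x))\<^sup>2)"
      by (simp add: norm_mult)
  qed simp
qed

lemma L2_restrict_space:
  assumes "u \<in> L2 M" "B \<inter> space M \<in> sets M"
  shows "u \<in> L2 (restrict_space M B)"
proof -
  have "l2sq (restrict_space M B) u \<le> l2sq M u"
    unfolding l2sq_def nn_integral_restrict_space[OF assms(2)]
    by (intro nn_integral_mono) (auto simp: indicator_def)
  then show ?thesis
    using assms(1) by (auto simp: L2_def measurable_restrict_space1)
qed

lemma lebesgue_on_restrict:
  assumes "open D" "open E" "D \<subseteq> E"
  shows "restrict_space (lebesgue_on E) D = lebesgue_on D"
  using assms by (simp add: restrict_restrict_space Int_absorb1 Int_absorb2)

lemma L2_lebesgue_on_subset: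
  assumes "u \<in> L2 (lebesgue_on E)" "open D" "open E" "D \<subseteq> E"
  shows "u \<in> L2 (lebesgue_on D)"
proof -
  have "D \<inter> space (lebesgue_on E) \<in> sets (lebesgue_on E)"
    using assms by (auto simp: sets_restrict_space_iff Int_absorb2)
  from L2_restrict_space[OF assms(1) this] show ?thesis
    by (simp add: lebesgue_on_restrict assms)
qed

lemma L2_of_bounded_support:
  fixes \<phi> :: "real^'d \<Rightarrow> complex"
  assumes [measurable]: "\<phi> \<in> borel_measurable borel"
    and "bounded S" "S \<in> sets borel" "D \<in> sets lebesgue"
    and supp: "\<And>x. x \<notin> S \<Longrightarrow> \<phi> x = 0" and bnd: "\<And>x. norm (\<phi> x) \<le> B"
  shows "\<phi> \<in> L2 (lebesgue_on D)"
proof -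
  have [measurable]: "\<phi> \<in> borel_measurable lebesgue"
    by (simp add: borel_measurable_if_I measurable_completion)
  have fin: "emeasure lebesgue S < \<infinity>"
    using assms(2,3) emeasure_bounded_finite[of S] by simp
  have "l2sq (lebesgue_on D) \<phi> \<le> (\<integral>\<^sup>+x. ennreal (B\<^sup>2) * indicator S x \<partial>lebesgue)"
    unfolding l2sq_def
    using assms(4) supp bnd
    by (subst nn_integral_restrict_space)
       (auto intro!: nn_integral_mono ennreal_leI power_mono simp: indicator_def)
  also have "\<dots> = ennreal (B\<^sup>2) * emeasure lebesgue S"
    using assms(3) by (intro nn_integral_cmult_indicator) auto
  also have "\<dots> < \<infinity>"
    using fin by (simp add: ennreal_mult_less_top)
  finally show ?thesis
    by (auto simp: L2_def measurable_restrict_space1)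
qed

lemma L2_indicator_bounded:
  assumes "bounded S" "S \<in> sets borel" "D \<in> sets lebesgue"
  shows "(\<lambda>x::real^'d. indicator S x :: complex) \<in> L2 (lebesgue_on D)"
  using assms by (intro L2_of_bounded_support[where S=S and B=1]) (auto simp: indicator_def)

section \<open>The fundamental lemma of the calculus of variations\<close>

text \<open>
  Box bumps are test functions converging boundedly to the indicator of the box, so dominated
  convergence transfers the vanishing of integrals from test functions to boxes.\<close>

lemma integral_cbox_eq_0:
  fixes G :: "real^'d \<Rightarrow> complex"
  assumes "open D" and G: "G \<in> L2 (lebesgue_on D)"
    and zero: "\<And>\<phi>. \<phi> \<in> test_functions D \<Longrightarrow>
      (LINT x|lebesgue_on D. G x * of_real (\<phi> x)) = 0"
    and sub: "cbox a b \<subseteq> D"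
  shows "set_integrable lebesgue (cbox a b) G" "integral (cbox a b) G = 0"
proof -
  have [measurable]: "G \<in> borel_measurable (lebesgue_on D)"
    using G by (simp add: L2_def)
  have D: "D \<inter> space lebesgue \<in> sets lebesgue"
    using assms(1) by simp
  have int: "integrable (lebesgue_on D) (\<lambda>x. G x * indicator S x)"
    if "S = cbox a b \<or> S = box a b" for S
    using that assms(1) by (intro integrable_L2_mult[OF G] L2_indicator_bounded) auto
  have set: "set_integrable lebesgue S G"
    "(LINT x:S|lebesgue. G x) = (LINT x|lebesgue_on D. G x * indicator S x)"
    if "S = cbox a b \<or> S = box a b" for S
  proof -
    have "S \<subseteq> D"
      using that sub box_subset_cbox by blast
    then have eq: "indicator D x *\<^sub>R (G x * indicator S x) = indicator S x *\<^sub>R G x" for x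
      by (auto simp: indicator_def)
    show "set_integrable lebesgue S G"
      using int[OF that] unfolding integrable_restrict_space[OF D] eq set_integrable_def .
    show "(LINT x:S|lebesgue. G x) = (LINT x|lebesgue_on D. G x * indicator S x)"
      unfolding integral_restrict_space[OF D] eq set_lebesgue_integral_def ..
  qed
  show "set_integrable lebesgue (cbox a b) G"
    by (rule set) simp
  have meas: "(\<lambda>x. box_bump (real (Suc m)) a b x) \<in> borel_measurable (lebesgue_on D)" for m
  proof -
    have "box_bump (real (Suc m)) a b \<in> borel_measurable borel"
      using C_k_box_bump[of 0] by (auto intro: borel_measurable_continuous_onI)
    then show ?thesis
      by (simp add: measurable_completion measurable_restrict_space1)
  qed
  have "(\<lambda>m. LINT x|lebesgue_on D. G x * of_real (box_bump (real (Suc m)) a b x))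
      \<longlonglongrightarrow> (LINT x|lebesgue_on D. G x * indicator (box a b) x)"
  proof (rule integral_dominated_convergence)
    show "integrable (lebesgue_on D) (\<lambda>x. norm (G x * indicator (box a b) x))"
      by (intro integrable_norm int) simp
    show "AE x in lebesgue_on D. (\<lambda>m. G x * of_real (box_bump (real (Suc m)) a b x))
        \<longlonglongrightarrow> G x * indicator (box a b) x"
    proof (intro AE_I2)
      fix x
      have "(\<lambda>m. G x * of_real (box_bump (real (Suc m)) a b x))
          \<longlonglongrightarrow> G x * of_real (indicator (box a b) x)"
        by (intro tendsto_intros box_bump_tendsto)
      also have "complex_of_real (indicator (box a b) x) = indicator (box a b) x"
        by (simp add: indicator_def)
      finally show "(\<lambda>m. G x * of_real (box_bump (real (Suc m)) a b x))
          \<longlonglongrightarrow> G x * indicator (box a b) x" .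
    qed
    show "AE x in lebesgue_on D. norm (G x * of_real (box_bump (real (Suc m)) a b x))
        \<le> norm (G x * indicator (box a b) x)" for m
    proof (intro AE_I2)
      fix x
      show "norm (G x * of_real (box_bump (real (Suc m)) a b x)) \<le> norm (G x * indicator (box a b) x)"
        using box_bump_bounds[of "real (Suc m)" a b x] box_bump_eq_0[of "real (Suc m)" x a b]
        by (cases "x \<in> box a b") (auto simp: norm_mult mult_left_le)
    qed
    show "(\<lambda>x. G x * of_real (box_bump (real (Suc m)) a b x)) \<in> borel_measurable (lebesgue_on D)" for m
      using meas by (intro borel_measurable_times borel_measurable_of_real) auto
    show "(\<lambda>x. G x * indicator (box a b) x) \<in> borel_measurable (lebesgue_on D)"
      using int[of "box a b"] by (simp add: borel_measurable_integrable)
  qed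
  moreover have "(LINT x|lebesgue_on D. G x * of_real (box_bump (real (Suc m)) a b x)) = 0" for m
    by (intro zero box_bump_test_function sub) simp
  ultimately have "(\<lambda>m::nat. 0) \<longlonglongrightarrow> (LINT x|lebesgue_on D. G x * indicator (box a b) x)"
    by simp
  then have "0 = (LINT x|lebesgue_on D. G x * indicator (box a b) x)"
    by (rule LIMSEQ_unique[OF tendsto_const])
  also have "\<dots> = integral (box a b) G"
    using set[of "box a b"] set_lebesgue_integral_eq_integral(2)[of "box a b" G] by simp
  finally show "integral (cbox a b) G = 0"
    by (simp add: integral_open_interval)
qed

lemma cbox_add_One_subset:
  assumes "open U" "x \<in> U"
  obtains d where "d > 0" "\<And>h. 0 < h \<Longrightarrow> h < d \<Longrightarrow> cbox x (x + h *\<^sub>R One) \<subseteq> U"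
proof -
  obtain r where r: "r > 0" "ball x r \<subseteq> U"
    using assms open_contains_ball by blast
  show ?thesis
  proof
    show "r / DIM('a) > 0"
      using r by simp
    fix h :: real assume h: "0 < h" "h < r / DIM('a)"
    show "cbox x (x + h *\<^sub>R One) \<subseteq> U"
    proof
      fix y assume y: "y \<in> cbox x (x + h *\<^sub>R One)"
      have "norm (y - x) \<le> (\<Sum>i\<in>Basis. \<bar>(y - x) \<bullet> i\<bar>)"
        by (rule norm_le_l1)
      also have "\<dots> \<le> (\<Sum>i\<in>(Basis::'a set). h)"
        using y by (intro sum_mono) (auto simp: mem_box inner_simps algebra_simps)
      also have "\<dots> < r"
        using h(2) by (simp add: field_simps)
      finally show "y \<in> U"
        using r(2) by (auto simp: dist_norm norm_minus_commute)
    qed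
  qed
qed

text \<open>
  By Lebesgue differentiation over boxes, \<open>G\<close> is almost everywhere a limit of its averages over small
  boxes, and all of these averages vanish.  The argument is local: around each point of the open set
  \<open>D\<close> the function is cut off to a box inside \<open>D\<close>, where it is integrable.\<close>

lemma fundamental_lemma_calculus_of_variations:
  fixes G :: "real^'d \<Rightarrow> complex"
  assumes "open D" and G: "G \<in> L2 (lebesgue_on D)"
    and zero: "\<And>\<phi>. \<phi> \<in> test_functions D \<Longrightarrow>
      (LINT x|lebesgue_on D. G x * of_real (\<phi> x)) = 0"
  shows "AE x in lebesgue_on D. G x = 0"
proof -
  define S where "S = {x \<in> D. G x \<noteq> 0}"
  have "\<exists>U. openin (top_of_set S) U \<and> x \<in> U \<and> negligible U" if "x \<in> S" for x
  proof -
    have "x \<in> D"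
      using that by (simp add: S_def)
    then obtain a b where ab: "cbox a b \<subseteq> D" "x \<in> box a b"
      by (rule open_contains_cbox[OF assms(1)])
    \<comment> \<open>Lebesgue differentiation is stated for functions integrable over every box.\<close>
    define f where "f = (\<lambda>x. if x \<in> cbox a b then G x else 0)"
    have "G integrable_on cbox a b"
      using integral_cbox_eq_0(1)[OF assms ab(1)] set_lebesgue_integral_eq_integral(1) by blast
    then have "f integrable_on UNIV"
      unfolding f_def by (simp add: integrable_restrict_UNIV)
    then have "f integrable_on cbox c d" for c d
      by (rule integrable_on_subcbox) simp
    then obtain N where N: "negligible N"
       "\<And>x e. \<lbrakk>x \<notin> N; 0 < e\<rbrakk> \<Longrightarrow> \<exists>d>0. \<forall>h. 0 < h \<and> h < d \<longrightarrow>
            norm (integral (cbox x (x + h *\<^sub>R One)) f /\<^sub>R h ^ DIM(real^'d) - f x) < e"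
      using integrable_ccontinuous_explicit by blast
    have "y \<in> N" if y: "y \<in> S \<inter> box a b" for y
    proof (rule ccontr)
      assume "y \<notin> N"
      have "f y \<noteq> 0"
        using y box_subset_cbox[of a b] by (auto simp: S_def f_def)
      then obtain d where d: "d > 0" "\<And>h. 0 < h \<Longrightarrow> h < d \<Longrightarrow>
            norm (integral (cbox y (y + h *\<^sub>R One)) f /\<^sub>R h ^ DIM(real^'d) - f y) < norm (f y)"
        using N(2)[OF \<open>y \<notin> N\<close>, of "norm (f y)"] by auto
      obtain d' where d': "d' > 0" "\<And>h. 0 < h \<Longrightarrow> h < d' \<Longrightarrow> cbox y (y + h *\<^sub>R One) \<subseteq> box a b"
        using cbox_add_One_subset[of "box a b" y] y by auto
      define h where "h = min d d' / 2"
      have h: "0 < h" "h < d" "h < d'"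
        using d(1) d'(1) by (auto simp: h_def)
      have sub: "cbox y (y + h *\<^sub>R One) \<subseteq> cbox a b"
        using d'(2)[OF h(1,3)] box_subset_cbox by blast
      have "integral (cbox y (y + h *\<^sub>R One)) f = integral (cbox y (y + h *\<^sub>R One)) G"
        using sub by (intro integral_cong) (auto simp: f_def)
      also have "\<dots> = 0"
        using sub ab(1) by (intro integral_cbox_eq_0(2)[OF assms]) auto
      \<comment> \<open>The average over this box is \<open>0\<close>, yet closer to \<open>f y\<close> than \<open>\<bar>f y\<bar>\<close>.\<close>
      finally show False
        using d(2)[OF h(1,2)] by simp
    qed
    then have "negligible (S \<inter> box a b)"
      by (intro negligible_subset[OF N(1)]) auto
    then show ?thesis
      using that ab(2) by (intro exI[of _ "S \<inter> box a b"]) auto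
  qed
  then have "negligible S"
    using locally_negligible_alt by blast
  then have "AE x in lebesgue. x \<notin> S"
    using negligible_iff_null_sets AE_not_in by blast
  then show ?thesis
    using assms(1) by (subst AE_restrict_space_iff) (auto simp: S_def)
qed

section \<open>Weak derivatives\<close>

text \<open>
  Gradients and Laplacians are picked by a choice operator.  What makes them
  usable is uniqueness almost everywhere, which yields linearity of the chosen gradient and
  compatibility of the chosen Laplacian with passing to a subdomain.\<close>

lemma test_function_continuous: "\<phi> \<in> test_functions D \<Longrightarrow> continuous_on UNIV \<phi>"
  unfolding test_functions_def using C_k.simps(1) by blast

lemma test_function_eq_0: "\<phi> \<in> test_functions D \<Longrightarrow> x \<notin> D \<Longrightarrow> \<phi> x = 0"
  using closure_subset[of "{x. \<phi> x \<noteq> 0}"] by (auto simp: test_functions_def)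

lemma test_functions_mono: "D \<subseteq> E \<Longrightarrow> test_functions D \<subseteq> test_functions E"
  by (auto simp: test_functions_def)

lemma partial_eq_0:
  assumes "x \<notin> closure {x. \<phi> x \<noteq> 0}"
  shows "partial i \<phi> x = 0"
proof -
  have "(\<phi> has_derivative (\<lambda>_. 0)) (at x)"
    by (rule has_derivative_transform_within_open[of "\<lambda>_. 0" _ _ _ "- closure {x. \<phi> x \<noteq> 0}"])
       (use assms closure_subset[of "{x. \<phi> x \<noteq> 0}"] in auto)
  then show ?thesis
    unfolding partial_def by (simp add: frechet_derivative_at[symmetric])
qed

lemma partial_test_function:
  assumes "\<phi> \<in> test_functions D"
  shows "partial i \<phi> \<in> test_functions D"
proof -
  have "{x. partial i \<phi> x \<noteq> 0} \<subseteq> closure {x. \<phi> x \<noteq> 0}"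
    using partial_eq_0 by blast
  then have sub: "closure {x. partial i \<phi> x \<noteq> 0} \<subseteq> closure {x. \<phi> x \<noteq> 0}"
    by (rule closure_minimal) simp
  have "C_k n (partial i \<phi>)" for n
  proof -
    have "C_k (Suc n) \<phi>"
      using assms by (simp only: test_functions_def mem_Collect_eq)
    then show ?thesis by simp
  qed
  moreover have "compact (closure {x. partial i \<phi> x \<noteq> 0})"
    using assms sub compact_Int_closed[of "closure {x. \<phi> x \<noteq> 0}" "closure {x. partial i \<phi> x \<noteq> 0}"]
    by (simp add: test_functions_def Int_absorb1)
  ultimately show ?thesis
    using assms sub by (auto simp: test_functions_def)
qed

lemma test_function_L2:
  assumes "\<phi> \<in> test_functions E" "D \<in> sets lebesgue"
  shows "(\<lambda>x. of_real (\<phi> x) :: complex) \<in> L2 (lebesgue_on D)"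
proof -
  define S where "S = closure {x. \<phi> x \<noteq> 0}"
  have S: "compact S" and out: "\<And>x. x \<notin> S \<Longrightarrow> \<phi> x = 0"
    using assms(1) closure_subset[of "{x. \<phi> x \<noteq> 0}"] by (auto simp: test_functions_def S_def)
  have cont: "continuous_on UNIV \<phi>"
    using assms(1) by (rule test_function_continuous)
  have "bounded (\<phi> ` S)"
    using S cont by (intro compact_imp_bounded compact_continuous_image) (auto intro: continuous_on_subset)
  then obtain B where "\<And>x. x \<in> S \<Longrightarrow> norm (\<phi> x) \<le> B"
    by (auto simp: bounded_iff)
  then have "norm (\<phi> x) \<le> max B 0" for x
    by (cases "x \<in> S") (auto simp: out le_max_iff_disj)
  then show ?thesis
    using S cont out assms(2)
    by (intro L2_of_bounded_support[where S=S and B="max B 0"])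
       (auto simp: compact_imp_bounded compact_imp_closed
          intro!: borel_measurable_continuous_onI continuous_intros)
qed

lemma integrable_test_function:
  assumes "u \<in> L2 (lebesgue_on D)" "\<phi> \<in> test_functions E" "open D"
  shows "integrable (lebesgue_on D) (\<lambda>x. u x * of_real (\<phi> x))"
  using assms by (intro integrable_L2_mult test_function_L2[of _ E]) auto

lemma L2_eq_AE_if_test_integrals_eq:
  fixes G H :: "real^'d \<Rightarrow> complex"
  assumes "open D" "G \<in> L2 (lebesgue_on D)" "H \<in> L2 (lebesgue_on D)"
    and "\<And>\<phi>. \<phi> \<in> test_functions D \<Longrightarrow>
      (LINT x|lebesgue_on D. G x * of_real (\<phi> x)) = (LINT x|lebesgue_on D. H x * of_real (\<phi> x))"
  shows "AE x in lebesgue_on D. G x = H x"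
proof -
  have "AE x in lebesgue_on D. G x - H x = 0"
    using assms integrable_test_function[OF _ _ assms(1)]
    by (intro fundamental_lemma_calculus_of_variations L2_diff)
       (auto simp: left_diff_distrib Bochner_Integration.integral_diff)
  then show ?thesis by auto
qed

lemma has_weak_gradient_unique:
  assumes "open D" "has_weak_gradient D u G" "has_weak_gradient D u H"
  shows "AE x in lebesgue_on D. G x = H x"
proof -
  have "AE x in lebesgue_on D. G x $ i = H x $ i" for i
    using assms(2,3) by (intro L2_eq_AE_if_test_integrals_eq assms(1)) (auto simp: has_weak_gradient_def)
  then have "AE x in lebesgue_on D. \<forall>i\<in>UNIV. G x $ i = H x $ i"
    by (intro AE_finite_allI) auto
  then show ?thesis by (auto simp: vec_eq_iff)
qed

lemma H1_L2: "u \<in> H1 D \<Longrightarrow> u \<in> L2 (lebesgue_on D)"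
  by (simp add: H1_def)

lemma has_weak_gradient_wgrad: "u \<in> H1 D \<Longrightarrow> has_weak_gradient D u (wgrad D u)"
  unfolding H1_def wgrad_def using someI_ex[of "has_weak_gradient D u"] by simp

lemma wgrad_L2: "u \<in> H1 D \<Longrightarrow> (\<lambda>x. wgrad D u x $ i) \<in> L2 (lebesgue_on D)"
  using has_weak_gradient_wgrad by (auto simp: has_weak_gradient_def)

lemma has_weak_gradient_lincomb:
  assumes "open D" "u \<in> L2 (lebesgue_on D)" "v \<in> L2 (lebesgue_on D)"
    and G: "has_weak_gradient D u G" and H: "has_weak_gradient D v H"
  shows "has_weak_gradient D (\<lambda>x. a * u x + b * v x) (\<lambda>x. \<chi> i. a * G x $ i + b * H x $ i)"
  unfolding has_weak_gradient_def
proof (intro conjI allI ballI)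
  fix i
  show "(\<lambda>x. (\<chi> i. a * G x $ i + b * H x $ i) $ i) \<in> L2 (lebesgue_on D)"
    using G H by (simp add: has_weak_gradient_def L2_add L2_scale)
next
  fix \<phi> i assume \<phi>: "\<phi> \<in> test_functions D"
  have lin: "(LINT x|lebesgue_on D. (a * p x + b * q x) * of_real (\<psi> x)) =
      a * (LINT x|lebesgue_on D. p x * of_real (\<psi> x)) + b * (LINT x|lebesgue_on D. q x * of_real (\<psi> x))"
    if "\<psi> \<in> test_functions D" "p \<in> L2 (lebesgue_on D)" "q \<in> L2 (lebesgue_on D)" for p q \<psi>
    using that integrable_test_function[OF _ that(1) assms(1)]
    by (simp add: distrib_right mult.assoc Bochner_Integration.integral_add)
  have "(LINT x|lebesgue_on D. (a * u x + b * v x) * of_real (partial i \<phi> x)) =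
      a * (LINT x|lebesgue_on D. u x * of_real (partial i \<phi> x)) +
      b * (LINT x|lebesgue_on D. v x * of_real (partial i \<phi> x))"
    by (intro lin partial_test_function \<phi> assms)
  also have "\<dots> = - (a * (LINT x|lebesgue_on D. G x $ i * of_real (\<phi> x)) +
      b * (LINT x|lebesgue_on D. H x $ i * of_real (\<phi> x)))"
    using G H \<phi> by (simp add: has_weak_gradient_def)
  also have "\<dots> = - (LINT x|lebesgue_on D. (a * G x $ i + b * H x $ i) * of_real (\<phi> x))"
    using G H by (subst lin[OF \<phi>]) (auto simp: has_weak_gradient_def)
  finally show "(LINT x|lebesgue_on D. (a * u x + b * v x) * of_real (partial i \<phi> x)) =
      - (LINT x|lebesgue_on D. (\<chi> i. a * G x $ i + b * H x $ i) $ i * of_real (\<phi> x))"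
    by simp
qed

lemma H1_lincomb:
  assumes "open D" "u \<in> H1 D" "v \<in> H1 D"
  shows "(\<lambda>x. a * u x + b * v x) \<in> H1 D"
    and wgrad_lincomb: "AE x in lebesgue_on D.
      wgrad D (\<lambda>x. a * u x + b * v x) x = (\<chi> i. a * wgrad D u x $ i + b * wgrad D v x $ i)"
proof -
  note g = has_weak_gradient_lincomb[OF assms(1) H1_L2[OF assms(2)] H1_L2[OF assms(3)]
      has_weak_gradient_wgrad[OF assms(2)] has_weak_gradient_wgrad[OF assms(3)], of a b]
  show 1: "(\<lambda>x. a * u x + b * v x) \<in> H1 D"
    using g assms H1_L2 unfolding H1_def by (auto intro!: L2_add L2_scale)
  show "AE x in lebesgue_on D.
      wgrad D (\<lambda>x. a * u x + b * v x) x = (\<chi> i. a * wgrad D u x $ i + b * wgrad D v x $ i)"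
    by (rule has_weak_gradient_unique[OF assms(1) has_weak_gradient_wgrad[OF 1] g])
qed

lemma H1_add: "open D \<Longrightarrow> u \<in> H1 D \<Longrightarrow> v \<in> H1 D \<Longrightarrow> (\<lambda>x. u x + v x) \<in> H1 D"
  using H1_lincomb(1)[of D u v 1 1] by simp

lemma H1_scale: "open D \<Longrightarrow> u \<in> H1 D \<Longrightarrow> (\<lambda>x. c * u x) \<in> H1 D"
  using H1_lincomb(1)[of D u u c 0] by simp

lemma H1_diff: "open D \<Longrightarrow> u \<in> H1 D \<Longrightarrow> v \<in> H1 D \<Longrightarrow> (\<lambda>x. u x - v x) \<in> H1 D"
  using H1_lincomb(1)[of D u v 1 "-1"] by simp

lemma H1_zero: "(\<lambda>x. 0) \<in> H1 D"
  unfolding H1_def by (auto simp: has_weak_gradient_def intro!: exI[of _ "\<lambda>x. 0"])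

lemma h1sq_scale:
  assumes "open D" "u \<in> H1 D"
  shows "h1sq D (\<lambda>x. c * u x) = ennreal ((norm c)\<^sup>2) * h1sq D u"
proof -
  have "AE x in lebesgue_on D. wgrad D (\<lambda>x. c * u x) x = (\<chi> i. c * wgrad D u x $ i)"
    using wgrad_lincomb[OF assms assms(2), of c 0] by simp
  then have "AE x in lebesgue_on D. wgrad D (\<lambda>x. c * u x) x $ i = c * wgrad D u x $ i" for i
    by eventually_elim simp
  from l2sq_cong_AE[OF this]
  have "l2sq (lebesgue_on D) (\<lambda>x. wgrad D (\<lambda>x. c * u x) x $ i)
      = ennreal ((norm c)\<^sup>2) * l2sq (lebesgue_on D) (\<lambda>x. wgrad D u x $ i)" for i
    by (simp add: l2sq_scale[OF L2_measurable[OF wgrad_L2[OF assms(2)]]])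
  then show ?thesis
    using l2sq_scale[OF L2_measurable[OF H1_L2[OF assms(2)]]]
    by (simp add: h1sq_def distrib_left sum_distrib_left)
qed

lemma h1sq_add_le:
  assumes "open D" "u \<in> H1 D" "v \<in> H1 D"
  shows "h1sq D (\<lambda>x. u x + v x) \<le> 2 * (h1sq D u + h1sq D v)"
proof -
  have "AE x in lebesgue_on D. wgrad D (\<lambda>x. u x + v x) x = (\<chi> i. wgrad D u x $ i + wgrad D v x $ i)"
    using wgrad_lincomb[OF assms, of 1 1] by simp
  then have "AE x in lebesgue_on D.
      wgrad D (\<lambda>x. u x + v x) x $ i = wgrad D u x $ i + wgrad D v x $ i" for i
    by eventually_elim simp
  from l2sq_cong_AE[OF this]
  have "l2sq (lebesgue_on D) (\<lambda>x. wgrad D (\<lambda>x. u x + v x) x $ i)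
      \<le> 2 * (l2sq (lebesgue_on D) (\<lambda>x. wgrad D u x $ i) + l2sq (lebesgue_on D) (\<lambda>x. wgrad D v x $ i))" for i
    using l2sq_add_le[OF L2_measurable[OF wgrad_L2[OF assms(2)]] L2_measurable[OF wgrad_L2[OF assms(3)]]]
    by simp
  then have "h1sq D (\<lambda>x. u x + v x)
      \<le> 2 * (l2sq (lebesgue_on D) u + l2sq (lebesgue_on D) v) +
        (\<Sum>i\<in>UNIV. 2 * (l2sq (lebesgue_on D) (\<lambda>x. wgrad D u x $ i) + l2sq (lebesgue_on D) (\<lambda>x. wgrad D v x $ i)))"
    unfolding h1sq_def using assms(2,3)
    by (intro add_mono sum_mono l2sq_add_le L2_measurable H1_L2)
  also have "\<dots> = 2 * (h1sq D u + h1sq D v)"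
    by (simp add: h1sq_def distrib_left sum.distrib sum_distrib_left ac_simps)
  finally show ?thesis .
qed

lemma LINT_lebesgue_on_subset:
  fixes f :: "real^'d \<Rightarrow> complex"
  assumes "open D" "open E" "D \<subseteq> E" "\<And>x. x \<notin> D \<Longrightarrow> f x = 0"
  shows "(LINT x|lebesgue_on D. f x) = (LINT x|lebesgue_on E. f x)"
  using assms by (simp add: integral_restrict_space indicator_def)
     (intro Bochner_Integration.integral_cong, auto)

lemma H1_subset:
  assumes "open D" "open E" "D \<subseteq> E" "u \<in> H1 E"
  shows "u \<in> H1 D"
proof -
  obtain G where G: "has_weak_gradient E u G"
    using assms by (auto simp: H1_def)
  have "has_weak_gradient D u G"
    unfolding has_weak_gradient_def
  proof (intro conjI allI ballI)
    fix i show "(\<lambda>x. G x $ i) \<in> L2 (lebesgue_on D)"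
      using G by (intro L2_lebesgue_on_subset[OF _ assms(1-3)]) (simp add: has_weak_gradient_def)
  next
    fix \<phi> i assume \<phi>: "\<phi> \<in> test_functions D"
    then have "\<phi> \<in> test_functions E"
      using test_functions_mono[OF assms(3)] by auto
    with G show "(LINT x|lebesgue_on D. u x * of_real (partial i \<phi> x)) =
        - (LINT x|lebesgue_on D. G x $ i * of_real (\<phi> x))"
      using \<phi> test_function_eq_0[OF \<phi>] test_function_eq_0[OF partial_test_function[OF \<phi>]]
      by (simp add: LINT_lebesgue_on_subset[OF assms(1-3)] has_weak_gradient_def)
  qed
  then show ?thesis
    using assms H1_L2 L2_lebesgue_on_subset by (auto simp: H1_def)
qed

lemma has_weak_laplacian_unique:
  assumes "open D" "has_weak_laplacian D u w" "has_weak_laplacian D u w'"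
  shows "AE x in lebesgue_on D. w x = w' x"
  using assms(2,3) by (intro L2_eq_AE_if_test_integrals_eq assms(1)) (auto simp: has_weak_laplacian_def)

lemma has_weak_laplacian_laplacian:
  "has_weak_laplacian D u w \<Longrightarrow> has_weak_laplacian D u (laplacian D u)"
  unfolding laplacian_def using someI[of "has_weak_laplacian D u" w] by simp

lemma has_weak_laplacian_subset:
  assumes "open D" "open E" "D \<subseteq> E" "has_weak_laplacian E u w"
  shows "has_weak_laplacian D u w"
  unfolding has_weak_laplacian_def
proof (intro conjI ballI)
  show "w \<in> L2 (lebesgue_on D)"
    using assms(4) by (intro L2_lebesgue_on_subset[OF _ assms(1-3)]) (simp add: has_weak_laplacian_def)
next
  fix \<phi> assume \<phi>: "\<phi> \<in> test_functions D"
  then have "\<phi> \<in> test_functions E"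
    using test_functions_mono[OF assms(3)] by auto
  with assms(4) show "(LINT x|lebesgue_on D. u x * of_real (\<Sum>i\<in>UNIV. partial i (partial i \<phi>) x)) =
        (LINT x|lebesgue_on D. w x * of_real (\<phi> x))"
    using test_function_eq_0[OF \<phi>]
      test_function_eq_0[OF partial_test_function[OF partial_test_function[OF \<phi>]]]
    by (simp add: LINT_lebesgue_on_subset[OF assms(1-3)] has_weak_laplacian_def)
qed

lemma laplacian_subset_AE:
  assumes "open D" "open E" "D \<subseteq> E" "has_weak_laplacian E u w"
  shows "AE x in lebesgue_on D. laplacian D u x = laplacian E u x"
proof -
  have "has_weak_laplacian D u (laplacian E u)"
    by (rule has_weak_laplacian_subset[OF assms(1-3) has_weak_laplacian_laplacian[OF assms(4)]])
  then show ?thesis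
    using has_weak_laplacian_unique[OF assms(1)] has_weak_laplacian_laplacian by blast
qed

section \<open>Existence of the trace operator\<close>

lemma sets_hausdorff_measure [simp]: "sets (hausdorff_measure s) = sets borel"
  unfolding hausdorff_measure_def
  by (simp add: sets.sigma_sets_eq[of borel, simplified])

lemma space_hausdorff_measure [simp]: "space (hausdorff_measure s) = UNIV"
  using sets_eq_imp_space_eq[OF sets_hausdorff_measure] by simp

lemma continuous_on_measurable_surf:
  assumes "continuous_on S u"
  shows "(u :: real^'d \<Rightarrow> complex) \<in> borel_measurable (surf S)"
proof -
  have "sets (surf S) = sets (restrict_space borel S)"
    by (simp add: surf_def sets_restrict_space)
  then show ?thesis
    using borel_measurable_continuous_on_restrict[OF assms] measurable_cong_sets by blast
qed

lemma has_trace_zero: "has_trace D (\<lambda>x. 0) (\<lambda>x. 0)" if "open D"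
proof -
  have "h1sq D (\<lambda>x. 0) = 0"
    using h1sq_scale[OF that H1_zero, of 0] by simp
  then show ?thesis
    unfolding has_trace_def by (intro conjI exI[of _ "\<lambda>n x. 0"]) (auto simp: H1_zero)
qed

lemma has_trace_scale:
  assumes "open D" "u \<in> H1 D" "has_trace D u t"
  shows "has_trace D (\<lambda>x. c * u x) (\<lambda>x. c * t x)"
proof -
  let ?S = "surf (frontier D)"
  obtain \<phi> where \<phi>: "\<And>n. \<phi> n \<in> H1 D" "\<And>n. continuous_on (closure D) (\<phi> n)"
      "(\<lambda>n. h1sq D (\<lambda>x. \<phi> n x - u x)) \<longlonglongrightarrow> 0" "(\<lambda>n. l2sq ?S (\<lambda>x. \<phi> n x - t x)) \<longlonglongrightarrow> 0"
    and t: "t \<in> L2 ?S"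
    using assms(3) by (auto simp: has_trace_def)
  have meas: "\<phi> n \<in> borel_measurable ?S" for n
    using \<phi>(2)[of n] by (intro continuous_on_measurable_surf)
      (rule continuous_on_subset, auto simp: frontier_def)
  have 1: "h1sq D (\<lambda>x. c * \<phi> n x - c * u x) = ennreal ((norm c)\<^sup>2) * h1sq D (\<lambda>x. \<phi> n x - u x)" for n
    using h1sq_scale[OF assms(1) H1_diff[OF assms(1) \<phi>(1) assms(2)], of c n]
    by (simp add: right_diff_distrib)
  have 2: "l2sq ?S (\<lambda>x. c * \<phi> n x - c * t x) = ennreal ((norm c)\<^sup>2) * l2sq ?S (\<lambda>x. \<phi> n x - t x)" for n
    using l2sq_scale[OF borel_measurable_diff[OF meas[of n] L2_measurable[OF t]], of c]
    by (simp add: right_diff_distrib)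
  have "(\<lambda>n. h1sq D (\<lambda>x. c * \<phi> n x - c * u x)) \<longlonglongrightarrow> 0"
    unfolding 1 using ennreal_tendsto_cmult[OF _ \<phi>(3), of "ennreal ((norm c)\<^sup>2)"] by simp
  moreover have "(\<lambda>n. l2sq ?S (\<lambda>x. c * \<phi> n x - c * t x)) \<longlonglongrightarrow> 0"
    unfolding 2 using ennreal_tendsto_cmult[OF _ \<phi>(4), of "ennreal ((norm c)\<^sup>2)"] by simp
  ultimately show ?thesis
    unfolding has_trace_def using t \<phi>(1,2) assms(1)
    by (intro conjI exI[of _ "\<lambda>n x. c * \<phi> n x"] allI L2_scale H1_scale continuous_intros)
qed

lemma has_trace_add:
  fixes D :: "(real^'d) set"
  assumes "open D" "u \<in> H1 D" "v \<in> H1 D" "has_trace D u s" "has_trace D v t"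
  shows "has_trace D (\<lambda>x. u x + v x) (\<lambda>x. s x + t x)"
proof -
  let ?S = "surf (frontier D)"
  have meas: "\<phi> \<in> borel_measurable ?S" if "continuous_on (closure D) \<phi>"
    for \<phi> :: "real^'d \<Rightarrow> complex"
    using that by (intro continuous_on_measurable_surf)
      (rule continuous_on_subset, auto simp: frontier_def)
  have lim: "f \<longlonglongrightarrow> 0"
    if "g \<longlonglongrightarrow> 0" "h \<longlonglongrightarrow> 0" "\<And>n. f n \<le> 2 * (g n + h n)" for f g h :: "nat \<Rightarrow> ennreal"
  proof (rule tendsto_sandwich[OF _ _ tendsto_const])
    show "(\<lambda>n. 2 * (g n + h n)) \<longlonglongrightarrow> 0"
      using ennreal_tendsto_cmult[OF _ tendsto_add[OF that(1,2)], of 2] by simp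
  qed (use that(3) in auto)
  obtain \<phi> where \<phi>: "\<And>n. \<phi> n \<in> H1 D" "\<And>n. continuous_on (closure D) (\<phi> n)"
      "(\<lambda>n. h1sq D (\<lambda>x. \<phi> n x - u x)) \<longlonglongrightarrow> 0" "(\<lambda>n. l2sq ?S (\<lambda>x. \<phi> n x - s x)) \<longlonglongrightarrow> 0"
    and s: "s \<in> L2 ?S"
    using assms(4) by (auto simp: has_trace_def)
  obtain \<psi> where \<psi>: "\<And>n. \<psi> n \<in> H1 D" "\<And>n. continuous_on (closure D) (\<psi> n)"
      "(\<lambda>n. h1sq D (\<lambda>x. \<psi> n x - v x)) \<longlonglongrightarrow> 0" "(\<lambda>n. l2sq ?S (\<lambda>x. \<psi> n x - t x)) \<longlonglongrightarrow> 0"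
    and t: "t \<in> L2 ?S"
    using assms(5) by (auto simp: has_trace_def)
  have "(\<lambda>n. h1sq D (\<lambda>x. (\<phi> n x + \<psi> n x) - (u x + v x))) \<longlonglongrightarrow> 0"
    using h1sq_add_le[OF assms(1) H1_diff[OF assms(1) \<phi>(1) assms(2)] H1_diff[OF assms(1) \<psi>(1) assms(3)]]
    by (intro lim[OF \<phi>(3) \<psi>(3)]) (simp add: add_diff_add)
  moreover have "(\<lambda>n. l2sq ?S (\<lambda>x. (\<phi> n x + \<psi> n x) - (s x + t x))) \<longlonglongrightarrow> 0"
    using l2sq_add_le[OF borel_measurable_diff[OF meas[OF \<phi>(2)] L2_measurable[OF s]]
        borel_measurable_diff[OF meas[OF \<psi>(2)] L2_measurable[OF t]]]
    by (intro lim[OF \<phi>(4) \<psi>(4)]) (simp add: add_diff_add)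
  ultimately show ?thesis
    unfolding has_trace_def using s t \<phi>(1,2) \<psi>(1,2) assms(1)
    by (intro conjI exI[of _ "\<lambda>n x. \<phi> n x + \<psi> n x"] allI L2_add H1_add continuous_intros)
qed

text \<open>
  The defining properties of a trace operator ask for a linear map on \<open>H\<^sup>1(D)\<close> into \<open>L\<^sup>2(\<partial>D)\<close> that picks
  some trace wherever one exists.  Such a map is a linear selection of the relation that \<open>t\<close> is a trace
  of \<open>u\<close>, which is closed under linear combinations: choose a trace for each member of a
  Hamel basis of the functions that have one, extend this basis to one of \<open>H\<^sup>1(D)\<close>, send the new basis
  elements to \<open>0\<close>, and extend linearly.\<close>

lemma is_trace_operator_bdry_trace:
  assumes "open D"
  shows "is_trace_operator (D :: (real^'d) set) (bdry_trace D)"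
proof -
  let ?s = "\<lambda>(c::complex) (u :: real^'d \<Rightarrow> complex) x. c * u x"
  interpret V: vector_space_pair ?s ?s
    by unfold_locales (auto simp: fun_eq_iff algebra_simps)
  let ?S = "surf (frontier D)"
  define T where "T = {u \<in> H1 D. \<exists>t. has_trace D u t}"
  obtain B where B: "B \<subseteq> T" "V.vs1.independent B" "T \<subseteq> V.vs1.span B"
    using V.vs1.maximal_independent_subset[of T] by blast
  have "B \<subseteq> H1 D"
    using B(1) by (auto simp: T_def)
  then obtain B' where B': "B \<subseteq> B'" "B' \<subseteq> H1 D" "V.vs1.independent B'" "H1 D \<subseteq> V.vs1.span B'"
    using V.vs1.maximal_independent_subset_extend[OF _ B(2)] by metis
  define \<tau> where "\<tau> u = (if u \<in> B then SOME t. has_trace D u t else (\<lambda>x. 0))" for u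
  have \<tau>: "has_trace D u (\<tau> u)" if "u \<in> B" for u
  proof -
    have "\<exists>t. has_trace D u t"
      using that B(1) by (auto simp: T_def)
    then show ?thesis
      using that someI_ex[of "has_trace D u"] by (simp add: \<tau>_def)
  qed
  obtain \<gamma> where \<gamma>: "Vector_Spaces.linear ?s ?s \<gamma>" "\<And>u. u \<in> B' \<Longrightarrow> \<gamma> u = \<tau> u"
    using V.linear_independent_extend[OF B'(3), of \<tau>] by blast
  have add: "\<gamma> (\<lambda>x. u x + v x) = (\<lambda>x. \<gamma> u x + \<gamma> v x)" for u v
    using V.linear_add[OF \<gamma>(1), of u v] by (simp add: plus_fun_def)
  have scale: "\<gamma> (\<lambda>x. c * u x) = (\<lambda>x. c * \<gamma> u x)" for c u
    using V.linear_scale[OF \<gamma>(1), of c u] by simp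
  have zero: "\<gamma> (\<lambda>x. 0) = (\<lambda>x. 0)"
    using scale[of 0 "\<lambda>x. 0"] by simp
  have L2: "\<gamma> u \<in> L2 ?S" if "u \<in> H1 D" for u
  proof -
    have "u \<in> V.vs1.span B'"
      using that B'(4) by blast
    then show ?thesis
    proof (rule V.vs1.span_induct)
      show "V.vs1.subspace {u. \<gamma> u \<in> L2 ?S}"
        unfolding V.vs1.subspace_def
        by (auto simp: plus_fun_def zero_fun_def add scale zero L2_add L2_scale)
    next
      fix u assume "u \<in> B'"
      then show "\<gamma> u \<in> L2 ?S"
        using \<gamma>(2)[of u] \<tau>[of u] by (auto simp: has_trace_def \<tau>_def)
    qed
  qed
  have trace: "u \<in> H1 D \<and> has_trace D u (\<gamma> u)" if "u \<in> T" for u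
  proof -
    have "u \<in> V.vs1.span B"
      using that B(3) by blast
    then show ?thesis
    proof (rule V.vs1.span_induct)
      show "V.vs1.subspace {u. u \<in> H1 D \<and> has_trace D u (\<gamma> u)}"
        unfolding V.vs1.subspace_def using assms
        by (auto simp: plus_fun_def zero_fun_def add scale zero
            H1_add H1_scale H1_zero has_trace_add has_trace_scale has_trace_zero)
    next
      fix u assume "u \<in> B"
      then show "u \<in> H1 D \<and> has_trace D u (\<gamma> u)"
        using \<tau>[of u] \<gamma>(2)[of u] B' by auto
    qed
  qed
  have "is_trace_operator D \<gamma>"
    unfolding is_trace_operator_def
  proof (intro conjI ballI allI impI)
    show "has_trace D u (\<gamma> u)" if "u \<in> H1 D" "\<exists>t. has_trace D u t" for u
      using trace[of u] that unfolding T_def by blast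
  qed (simp_all add: L2 add scale)
  then show ?thesis
    unfolding bdry_trace_def by (rule someI[of "is_trace_operator D"])
qed

section \<open>The boundary of a Lipschitz domain is a null set\<close>

text \<open>
  The graph is the image of a hyperplane, a null set, under the Lipschitz map \<open>z \<mapsto> z + \<psi>(z) e\<close> from the
  space to itself.\<close>

lemma negligible_lipschitz_graph:
  fixes e :: "real^'d"
  assumes e: "norm e = 1" and \<psi>: "L-lipschitz_on UNIV \<psi>"
  shows "negligible {y. y \<bullet> e = \<psi> (y - (y \<bullet> e) *\<^sub>R e)}"
proof -
  define H where "H = {z. e \<bullet> z = 0}"
  define F where "F z = z + \<psi> z *\<^sub>R e" for z
  have "e \<noteq> 0" using e by auto
  then have "negligible H"
    unfolding H_def by (intro negligible_hyperplane) simp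
  then have "negligible (F ` H)"
  proof (rule negligible_locally_Lipschitz_image[OF order_refl])
    fix x
    have "norm (F y - F x) \<le> (1 + L) * norm (y - x)" for y
    proof -
      have "F y - F x = (y - x) + (\<psi> y - \<psi> x) *\<^sub>R e"
        by (simp add: F_def algebra_simps)
      then have "norm (F y - F x) \<le> norm (y - x) + \<bar>\<psi> y - \<psi> x\<bar>"
        using norm_triangle_ineq[of "y - x" "(\<psi> y - \<psi> x) *\<^sub>R e"] e by simp
      also have "\<bar>\<psi> y - \<psi> x\<bar> \<le> L * norm (y - x)"
        using lipschitz_onD[OF \<psi>, of y x] by (simp add: dist_norm)
      finally show ?thesis by (simp add: algebra_simps)
    qed
    then show "\<exists>T B. open T \<and> x \<in> T \<and> (\<forall>y\<in>H \<inter> T. norm (F y - F x) \<le> B * norm (y - x))"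
      by (intro exI[of _ UNIV] exI[of _ "1 + L"]) auto
  qed
  moreover have "{y. y \<bullet> e = \<psi> (y - (y \<bullet> e) *\<^sub>R e)} \<subseteq> F ` H"
  proof
    fix y assume "y \<in> {y. y \<bullet> e = \<psi> (y - (y \<bullet> e) *\<^sub>R e)}"
    then have "y = F (y - (y \<bullet> e) *\<^sub>R e)"
      by (simp add: F_def)
    moreover have "y - (y \<bullet> e) *\<^sub>R e \<in> H"
      using e by (simp add: H_def inner_diff_right inner_commute norm_eq_1)
    ultimately show "y \<in> F ` H"
      by (rule image_eqI)
  qed
  ultimately show ?thesis
    by (rule negligible_subset)
qed

text \<open>
  In a chart, points strictly below the graph are interior and points strictly above it are exterior,
  so the boundary lies in the graph.\<close>

lemma negligible_frontier_lipschitz: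
  fixes D :: "(real^'d) set"
  assumes "lipschitz_boundary D"
  shows "negligible (frontier D)"
proof -
  have "\<exists>V. openin (top_of_set (frontier D)) V \<and> x \<in> V \<and> negligible V" if "x \<in> frontier D" for x
  proof -
    from bspec[OF assms[unfolded lipschitz_boundary_def] that]
    obtain U e \<psi> L where U: "open U" "x \<in> U" and e: "norm e = 1" and \<psi>: "L-lipschitz_on UNIV \<psi>"
      and D: "D \<inter> U = {y \<in> U. y \<bullet> e < \<psi> (y - (y \<bullet> e) *\<^sub>R e)}"
      by (elim exE conjE) (rule that)
    define h where "h y = y \<bullet> e - \<psi> (y - (y \<bullet> e) *\<^sub>R e)" for y
    have D_iff: "y \<in> D \<longleftrightarrow> h y < 0" if "y \<in> U" for y
      using arg_cong[OF D, of "\<lambda>A. y \<in> A"] that by (simp add: h_def)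
    have cont: "continuous_on UNIV h"
      unfolding h_def
      by (intro continuous_intros continuous_on_compose2[OF lipschitz_on_continuous_on[OF \<psi>]]) auto
    have "h y = 0" if y: "y \<in> frontier D \<inter> U" for y
    proof (rule ccontr)
      assume "h y \<noteq> 0"
      then consider "h y < 0" | "h y > 0" by linarith
      then show False
      proof cases
        case 1
        have "open (U \<inter> h -` {..<0})"
          using U(1) cont by (intro open_Int open_vimage) auto
        moreover have "U \<inter> h -` {..<0} \<subseteq> D"
          using D_iff by auto
        ultimately have "y \<in> interior D"
          using 1 y by (intro interiorI) auto
        then show False
          using y by (simp add: frontier_def)
      next
        case 2
        have "open (U \<inter> h -` {0<..})"
          using U(1) cont by (intro open_Int open_vimage) auto
        moreover have "y \<in> closure D"
          using y by (simp add: frontier_def)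
        ultimately have "U \<inter> h -` {0<..} \<inter> D \<noteq> {}"
          using 2 y open_Int_closure_eq_empty[of "U \<inter> h -` {0<..}" D] by auto
        then show False
          using D_iff by auto
      qed
    qed
    then have "negligible (frontier D \<inter> U)"
      by (intro negligible_subset[OF negligible_lipschitz_graph[OF e \<psi>]]) (auto simp: h_def)
    then show ?thesis
      using U that by (intro exI[of _ "frontier D \<inter> U"]) auto
  qed
  then show ?thesis
    using locally_negligible_alt by blast
qed

section \<open>Green's identity for the Helmholtz form\<close>

lemma bdry_trace_L2: "open D \<Longrightarrow> u \<in> H1 D \<Longrightarrow> bdry_trace D u \<in> L2 (surf (frontier D))"
  using is_trace_operator_bdry_trace[of D] by (simp add: is_trace_operator_def)

lemma bdry_trace_diff:
  assumes "open D" "u \<in> H1 D" "v \<in> H1 D"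
  shows "AE x in surf (frontier D). bdry_trace D (\<lambda>y. u y - v y) x = bdry_trace D u x - bdry_trace D v x"
proof -
  note tr = is_trace_operator_bdry_trace[OF assms(1), unfolded is_trace_operator_def]
  note add = tr[THEN conjunct2, THEN conjunct1, rule_format]
    and scale = tr[THEN conjunct2, THEN conjunct2, THEN conjunct1, rule_format]
  from add[OF assms(2) H1_scale[OF assms(1,3), of "- 1"]] scale[OF assms(3), of "- 1"]
  show ?thesis
    by eventually_elim simp
qed

lemma U_space_D:
  assumes "v \<in> U_space D"
  shows "v \<in> H1 D" "has_weak_laplacian D v (laplacian D v)" "\<exists>h. has_normal_derivative D v h"
  using assms has_weak_laplacian_laplacian by (auto simp: U_space_def)

lemma has_normal_derivative_normal_derivative:
  "has_normal_derivative D v h \<Longrightarrow> has_normal_derivative D v (normal_derivative D v)"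
  unfolding normal_derivative_def using someI[of "has_normal_derivative D v" h] by simp

lemma impedance_trace_L2:
  assumes "open D" "v \<in> H1 D" "has_normal_derivative D v h"
  shows "impedance_trace k D v \<in> L2 (surf (frontier D))"
proof -
  have "normal_derivative D v \<in> L2 (surf (frontier D))"
    using has_normal_derivative_normal_derivative[OF assms(3)] by (simp add: has_normal_derivative_def)
  then show ?thesis
    unfolding impedance_trace_def[abs_def] by (intro L2_diff L2_scale bdry_trace_L2 assms)
qed

lemma integrable_wgrad_inner:
  assumes "u \<in> H1 D" "v \<in> H1 D"
  shows "integrable (lebesgue_on D) (\<lambda>x. \<Sum>i\<in>UNIV. wgrad D u x $ i * cnj (wgrad D v x $ i))"
  using assms by (intro Bochner_Integration.integrable_sum integrable_L2_mult L2_cnj wgrad_L2)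

text \<open>
  The weak normal derivative is defined by Green's identity; subtracting \<open>k\<^sup>2v\<close> in the
  domain and \<open>ikv\<close> on the boundary turns \<open>\<Delta>v\<close> into \<open>(\<Delta> + k\<^sup>2)v\<close> and \<open>\<partial>v/\<partial>n\<close> into the impedance trace.\<close>

lemma a_form_green:
  assumes "open D" "v \<in> H1 D" "has_weak_laplacian D v l" "has_normal_derivative D v h" "w \<in> H1 D"
  shows "a_form k D v w =
    (LINT x|surf (frontier D). impedance_trace k D v x * cnj (bdry_trace D w x))
    - (LINT x|lebesgue_on D. (laplacian D v x + (of_real k)\<^sup>2 * v x) * cnj (w x))"
proof -
  let ?S = "surf (frontier D)"
  let ?g = "\<lambda>x. \<Sum>i\<in>UNIV. wgrad D v x $ i * cnj (wgrad D w x $ i)"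
  have lap: "laplacian D v \<in> L2 (lebesgue_on D)"
    using has_weak_laplacian_laplacian[OF assms(3)] by (simp add: has_weak_laplacian_def)
  have nd: "normal_derivative D v \<in> L2 ?S"
    and green: "(LINT x|lebesgue_on D. ?g x + laplacian D v x * cnj (w x)) =
        (LINT x|?S. normal_derivative D v x * cnj (bdry_trace D w x))"
    using has_normal_derivative_normal_derivative[OF assms(4)] assms(5)
    by (auto simp: has_normal_derivative_def)
  have i1: "integrable (lebesgue_on D) (\<lambda>x. ?g x + laplacian D v x * cnj (w x))"
    by (intro Bochner_Integration.integrable_add integrable_wgrad_inner integrable_L2_mult L2_cnj
        lap H1_L2 assms)
  have i2: "integrable (lebesgue_on D) (\<lambda>x. (laplacian D v x + (of_real k)\<^sup>2 * v x) * cnj (w x))"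
    by (intro integrable_L2_mult L2_add L2_scale L2_cnj lap H1_L2 assms)
  have i3: "integrable ?S (\<lambda>x. normal_derivative D v x * cnj (bdry_trace D w x))"
    by (intro integrable_L2_mult L2_cnj nd bdry_trace_L2 assms)
  have i4: "integrable ?S (\<lambda>x. bdry_trace D v x * cnj (bdry_trace D w x))"
    by (intro integrable_L2_mult L2_cnj bdry_trace_L2 assms)
  have "(LINT x|lebesgue_on D. ?g x - (of_real k)\<^sup>2 * v x * cnj (w x)) =
      (LINT x|lebesgue_on D. (?g x + laplacian D v x * cnj (w x))
          - (laplacian D v x + (of_real k)\<^sup>2 * v x) * cnj (w x))"
    by (simp add: algebra_simps)
  also have "\<dots> = (LINT x|?S. normal_derivative D v x * cnj (bdry_trace D w x))
      - (LINT x|lebesgue_on D. (laplacian D v x + (of_real k)\<^sup>2 * v x) * cnj (w x))"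
    using i1 i2 green by (simp add: Bochner_Integration.integral_diff)
  finally have vol: "(LINT x|lebesgue_on D. ?g x - (of_real k)\<^sup>2 * v x * cnj (w x)) = \<dots>" .
  have "(LINT x|?S. impedance_trace k D v x * cnj (bdry_trace D w x)) =
      (LINT x|?S. normal_derivative D v x * cnj (bdry_trace D w x)
        - \<i> * of_real k * (bdry_trace D v x * cnj (bdry_trace D w x)))"
    by (simp add: impedance_trace_def algebra_simps)
  also have "\<dots> = (LINT x|?S. normal_derivative D v x * cnj (bdry_trace D w x))
      - \<i> * of_real k * (LINT x|?S. bdry_trace D v x * cnj (bdry_trace D w x))"
    using i3 i4 by (simp add: Bochner_Integration.integral_diff)
  finally show ?thesis
    unfolding a_form_def vol by simp
qed

lemma integral_eq_AE:
  fixes F G :: "'a \<Rightarrow> complex"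
  assumes "integrable M F" "integrable M G" "AE x in M. F x = G x"
  shows "integral\<^sup>L M F = integral\<^sup>L M G"
  using assms by (intro integral_cong_AE borel_measurable_integrable)

lemma a_form_diff:
  assumes "open D" "u \<in> H1 D" "v \<in> H1 D" "w \<in> H1 D"
  shows "a_form k D (\<lambda>x. u x - v x) w = a_form k D u w - a_form k D v w"
proof -
  let ?S = "surf (frontier D)"
  let ?e = "\<lambda>u x. (\<Sum>i\<in>UNIV. wgrad D u x $ i * cnj (wgrad D w x $ i)) - (of_real k)\<^sup>2 * u x * cnj (w x)"
  let ?b = "\<lambda>u x. bdry_trace D u x * cnj (bdry_trace D w x)"
  note uv = H1_diff[OF assms(1-3)]
  have e: "integrable (lebesgue_on D) (?e p)" if "p \<in> H1 D" for p
    by (intro Bochner_Integration.integrable_diff integrable_wgrad_inner integrable_L2_mult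
        L2_cnj L2_scale H1_L2 that assms)
  have b: "integrable ?S (?b p)" if "p \<in> H1 D" for p
    by (intro integrable_L2_mult L2_cnj bdry_trace_L2 that assms)
  have "AE x in lebesgue_on D. wgrad D (\<lambda>x. u x - v x) x = (\<chi> i. wgrad D u x $ i - wgrad D v x $ i)"
    using wgrad_lincomb[OF assms(1-3), of 1 "- 1"] by simp
  then have "AE x in lebesgue_on D. ?e (\<lambda>x. u x - v x) x = ?e u x - ?e v x"
    by eventually_elim (simp add: algebra_simps sum_subtractf)
  then have "(LINT x|lebesgue_on D. ?e (\<lambda>x. u x - v x) x) = (LINT x|lebesgue_on D. ?e u x - ?e v x)"
    by (intro integral_eq_AE e[OF uv] Bochner_Integration.integrable_diff e assms)
  also have "\<dots> = (LINT x|lebesgue_on D. ?e u x) - (LINT x|lebesgue_on D. ?e v x)"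
    by (intro Bochner_Integration.integral_diff e assms)
  finally have vol: "(LINT x|lebesgue_on D. ?e (\<lambda>x. u x - v x) x) = \<dots>" .
  have "AE x in ?S. ?b (\<lambda>x. u x - v x) x = ?b u x - ?b v x"
    using bdry_trace_diff[OF assms(1-3)] by eventually_elim (simp add: left_diff_distrib)
  then have "(LINT x|?S. ?b (\<lambda>x. u x - v x) x) = (LINT x|?S. ?b u x - ?b v x)"
    by (intro integral_eq_AE b[OF uv] Bochner_Integration.integrable_diff b assms)
  also have "\<dots> = (LINT x|?S. ?b u x) - (LINT x|?S. ?b v x)"
    by (intro Bochner_Integration.integral_diff b assms)
  finally have bd: "(LINT x|?S. ?b (\<lambda>x. u x - v x) x) = \<dots>" .
  show ?thesis
    unfolding a_form_def vol bd by (simp add: algebra_simps)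
qed

section \<open>The corrections of the parallel Schwarz iteration\<close>

lemma surf_restrict:
  assumes "closed S" "R \<in> sets borel" "R \<subseteq> S"
  shows "restrict_space (surf S) R = surf R" "R \<inter> space (surf S) \<in> sets (surf S)"
  using assms
  by (auto simp: surf_def restrict_restrict_space Int_absorb1 Int_absorb2 sets_restrict_space_iff
      space_restrict_space)

lemma L2_surf_subset:
  assumes "u \<in> L2 (surf S)" "closed S" "R \<in> sets borel" "R \<subseteq> S"
  shows "u \<in> L2 (surf R)"
  using L2_restrict_space[OF assms(1) surf_restrict(2)[OF assms(2-)]] surf_restrict(1)[OF assms(2-)]
  by simp

lemma integral_surf_split:
  fixes F :: "real^'d \<Rightarrow> complex"
  assumes "closed S" "closed T" "integrable (surf S) F"
  shows "(LINT x|surf S. F x) = (LINT x|surf (S - T). F x) + (LINT x|surf (S \<inter> T). F x)"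
proof -
  let ?H = "hausdorff_measure (CARD('d) - 1) :: (real^'d) measure"
  have S: "S \<inter> space ?H \<in> sets ?H" and A: "(S - T) \<inter> space ?H \<in> sets ?H"
    and B: "S \<inter> T \<inter> space ?H \<in> sets ?H"
    using assms(1,2) by auto
  have int: "integrable ?H (\<lambda>x. indicator S x *\<^sub>R F x)"
    using assms(3) unfolding surf_def integrable_restrict_space[OF S] .
  have intR: "integrable ?H (\<lambda>x. indicator R x *\<^sub>R F x)" if "R \<in> sets borel" "R \<subseteq> S" for R
  proof -
    have "integrable ?H (\<lambda>x. indicator R x *\<^sub>R (indicator S x *\<^sub>R F x))"
      by (rule integrable_mult_indicator[OF _ int]) (simp add: that(1))
    also have "(\<lambda>x. indicator R x *\<^sub>R (indicator S x *\<^sub>R F x)) = (\<lambda>x. indicator R x *\<^sub>R F x)"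
      using that(2) by (auto simp: indicator_def fun_eq_iff)
    finally show ?thesis .
  qed
  have "(LINT x|surf S. F x) = (LINT x|?H. indicator (S - T) x *\<^sub>R F x + indicator (S \<inter> T) x *\<^sub>R F x)"
    unfolding surf_def integral_restrict_space[OF S]
    by (intro Bochner_Integration.integral_cong) (auto simp: indicator_def)
  also have "\<dots> = (LINT x|?H. indicator (S - T) x *\<^sub>R F x) + (LINT x|?H. indicator (S \<inter> T) x *\<^sub>R F x)"
    using assms(1,2) by (intro Bochner_Integration.integral_add intR) auto
  finally show ?thesis
    unfolding surf_def integral_restrict_space[OF A] integral_restrict_space[OF B] .
qed

text \<open>
  Green's identity on \<open>D\<close> for the local solution \<open>w\<close> and for the previous iterate \<open>u\<close>.  In the
  difference the equation replaces \<open>-(\<Delta> + k\<^sup>2)w\<close> by \<open>f\<close>, the transmission condition cancels the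
  boundary terms on the part of \<open>\<partial>D\<close> inside \<open>\<Omega>\<close>, and on the rest of \<open>\<partial>D\<close> the impedance trace of \<open>w\<close>
  is \<open>g\<close>.\<close>

lemma a_form_correction:
  fixes D \<Omega> :: "(real^'d) set"
  assumes D: "open D" and \<Omega>: "open \<Omega>" and sub: "D \<subseteq> \<Omega>"
    and f: "f \<in> L2 (lebesgue_on \<Omega>)" and g: "g \<in> L2 (surf (frontier \<Omega>))"
    and u: "u \<in> U_space \<Omega>" and nd: "has_normal_derivative D u h"
    and w: "w \<in> U_space D"
    and pde: "AE x in lebesgue_on D. - (laplacian D w x + (of_real k)\<^sup>2 * w x) = f x"
    and inner: "AE x in surf (frontier D - frontier \<Omega>). impedance_trace k D w x = impedance_trace k D u x"
    and outer: "AE x in surf (frontier D \<inter> frontier \<Omega>). impedance_trace k D w x = g x"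
    and v: "v \<in> H1 D"
  shows "a_form k D (\<lambda>x. w x - u x) v =
     (LINT x|lebesgue_on D. f x * cnj (v x))
     + (LINT x|surf (frontier D \<inter> frontier \<Omega>). g x * cnj (bdry_trace D v x))
     + (LINT x|lebesgue_on D. (laplacian \<Omega> u x + (of_real k)\<^sup>2 * u x) * cnj (v x))
     - (LINT x|surf (frontier D \<inter> frontier \<Omega>). impedance_trace k D u x * cnj (bdry_trace D v x))"
proof -
  let ?A = "frontier D - frontier \<Omega>" and ?B = "frontier D \<inter> frontier \<Omega>"
  let ?t = "\<lambda>x. cnj (bdry_trace D v x)"
  let ?iw = "impedance_trace k D w" and ?iu = "impedance_trace k D u"
  have uD: "u \<in> H1 D"
    by (rule H1_subset[OF D \<Omega> sub U_space_D(1)[OF u]])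
  have lapD: "has_weak_laplacian D u (laplacian \<Omega> u)"
    by (rule has_weak_laplacian_subset[OF D \<Omega> sub U_space_D(2)[OF u]])
  note wD = U_space_D[OF w]
  obtain h' where h': "has_normal_derivative D w h'"
    using wD(3) by blast
  have lap2: "laplacian D u \<in> L2 (lebesgue_on D)" "laplacian \<Omega> u \<in> L2 (lebesgue_on D)"
      "laplacian D w \<in> L2 (lebesgue_on D)"
    using lapD wD(2) has_weak_laplacian_laplacian[OF lapD] by (auto simp: has_weak_laplacian_def)
  have fD: "f \<in> L2 (lebesgue_on D)"
    by (rule L2_lebesgue_on_subset[OF f D \<Omega> sub])
  have t: "?t \<in> L2 (surf (frontier D))"
    by (intro L2_cnj bdry_trace_L2 D v)
  have iw: "?iw \<in> L2 (surf (frontier D))" and iu: "?iu \<in> L2 (surf (frontier D))"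
    using impedance_trace_L2[OF D wD(1) h'] impedance_trace_L2[OF D uD nd] by auto
  have "(LINT x|lebesgue_on D. (laplacian D w x + (of_real k)\<^sup>2 * w x) * cnj (v x))
      = (LINT x|lebesgue_on D. - (f x * cnj (v x)))"
  proof (rule integral_eq_AE)
    show "AE x in lebesgue_on D. (laplacian D w x + (of_real k)\<^sup>2 * w x) * cnj (v x) = - (f x * cnj (v x))"
      using pde by eventually_elim (metis minus_minus mult_minus_left)
  qed (intro integrable_L2_mult Bochner_Integration.integrable_minus L2_add L2_scale L2_cnj
      lap2 fD H1_L2 wD v)+
  then have vol_w: "(LINT x|lebesgue_on D. (laplacian D w x + (of_real k)\<^sup>2 * w x) * cnj (v x))
      = - (LINT x|lebesgue_on D. f x * cnj (v x))"
    by simp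
  have vol_u: "(LINT x|lebesgue_on D. (laplacian D u x + (of_real k)\<^sup>2 * u x) * cnj (v x))
      = (LINT x|lebesgue_on D. (laplacian \<Omega> u x + (of_real k)\<^sup>2 * u x) * cnj (v x))"
  proof (rule integral_eq_AE)
    show "AE x in lebesgue_on D. (laplacian D u x + (of_real k)\<^sup>2 * u x) * cnj (v x)
        = (laplacian \<Omega> u x + (of_real k)\<^sup>2 * u x) * cnj (v x)"
      using laplacian_subset_AE[OF D \<Omega> sub U_space_D(2)[OF u]] by eventually_elim simp
  qed (intro integrable_L2_mult L2_add L2_scale L2_cnj lap2 H1_L2 uD v)+
  have "(LINT x|surf (frontier D). ?iw x * ?t x) - (LINT x|surf (frontier D). ?iu x * ?t x)
      = (LINT x|surf (frontier D). (?iw x - ?iu x) * ?t x)"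
    using integrable_L2_mult[OF iw t] integrable_L2_mult[OF iu t]
    by (simp add: left_diff_distrib Bochner_Integration.integral_diff)
  also have "\<dots> = (LINT x|surf ?A. (?iw x - ?iu x) * ?t x) + (LINT x|surf ?B. (?iw x - ?iu x) * ?t x)"
    by (intro integral_surf_split integrable_L2_mult L2_diff iw iu t frontier_closed)
  also have "(LINT x|surf ?A. (?iw x - ?iu x) * ?t x) = 0"
  proof (rule integral_eq_zero_AE)
    show "AE x in surf ?A. (?iw x - ?iu x) * ?t x = 0"
      using inner by eventually_elim simp
  qed
  also have "(LINT x|surf ?B. (?iw x - ?iu x) * ?t x) = (LINT x|surf ?B. g x * ?t x - ?iu x * ?t x)"
  proof (rule integral_eq_AE)
    have B: "?B \<in> sets borel"
      by (intro borel_closed closed_Int frontier_closed)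
    have gB: "g \<in> L2 (surf ?B)"
      by (rule L2_surf_subset[OF g frontier_closed B]) auto
    have sB: "p \<in> L2 (surf ?B)" if "p \<in> L2 (surf (frontier D))" for p
      by (rule L2_surf_subset[OF that frontier_closed B]) auto
    show "AE x in surf ?B. (?iw x - ?iu x) * ?t x = g x * ?t x - ?iu x * ?t x"
      using outer by eventually_elim (simp add: left_diff_distrib)
    show "integrable (surf ?B) (\<lambda>x. (?iw x - ?iu x) * ?t x)"
      by (intro integrable_L2_mult L2_diff sB iw iu t)
    show "integrable (surf ?B) (\<lambda>x. g x * ?t x - ?iu x * ?t x)"
      by (intro Bochner_Integration.integrable_diff integrable_L2_mult gB sB iu t)
  qed
  also have "\<dots> = (LINT x|surf ?B. g x * ?t x) - (LINT x|surf ?B. ?iu x * ?t x)"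
  proof (rule Bochner_Integration.integral_diff)
    have B: "?B \<in> sets borel"
      by (intro borel_closed closed_Int frontier_closed)
    show "integrable (surf ?B) (\<lambda>x. g x * ?t x)" "integrable (surf ?B) (\<lambda>x. ?iu x * ?t x)"
      by (intro integrable_L2_mult L2_surf_subset[OF g frontier_closed B]
          L2_surf_subset[OF iu frontier_closed B] L2_surf_subset[OF t frontier_closed B]; simp)+
  qed
  finally have bd: "(LINT x|surf (frontier D). ?iw x * ?t x) - (LINT x|surf (frontier D). ?iu x * ?t x)
      = (LINT x|surf ?B. g x * ?t x) - (LINT x|surf ?B. ?iu x * ?t x)"
    by simp
  \<comment> \<open>pairs the boundary terms, so that \<open>bd\<close> applies to their difference\<close>
  have regroup: "(X - W) - (Y - V) = (X - Y) - W + V" for X W Y V :: complex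
    by simp
  show ?thesis
    unfolding a_form_diff[OF D wD(1) uD v] a_form_green[OF D wD(1,2) h' v]
      a_form_green[OF D uD lapD nd v] regroup bd vol_w vol_u
    by simp
qed

text \<open>
  The functions \<open>\<chi>\<^sub>l\<close> may be nonzero on the boundary of their subdomains, where the extension by zero
  discards them.  Points on the boundaries are therefore excluded, and the identity for the glued iterates
  is one that holds almost everywhere.\<close>

lemma partition_of_unity_zero_ext:
  assumes "partition_of_unity \<Omega> N \<Omega>s pu" "x \<in> \<Omega>" "\<And>l. l \<in> {1..N} \<Longrightarrow> x \<notin> frontier (\<Omega>s l)"
  shows "(\<Sum>l=1..N. zero_ext (\<Omega>s l) (\<lambda>y. of_real (pu l y)) x) = 1"
proof -
  have "zero_ext (\<Omega>s l) (\<lambda>y. of_real (pu l y)) x = of_real (pu l x)" if l: "l \<in> {1..N}" for l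
  proof (cases "x \<in> \<Omega>s l")
    case False
    then have "x \<notin> closure (\<Omega>s l)"
      using assms(3)[OF l] interior_subset by (auto simp: frontier_def)
    then have "pu l x = 0"
      using assms(1) l closure_subset[of "{x. pu l x \<noteq> 0}"] unfolding partition_of_unity_def by blast
    then show ?thesis
      using False by (simp add: zero_ext_def)
  qed (simp add: zero_ext_def)
  then have "(\<Sum>l=1..N. zero_ext (\<Omega>s l) (\<lambda>y. of_real (pu l y)) x) = of_real (\<Sum>l=1..N. pu l x)"
    by simp
  also have "(\<Sum>l=1..N. pu l x) = 1"
    using assms(1,2) closure_subset[of \<Omega>] unfolding partition_of_unity_def by blast
  finally show ?thesis by simp
qed

lemma glued_correction_AE:
  fixes \<Omega> :: "(real^'d) set" and u :: "real^'d \<Rightarrow> complex"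
  assumes "overlapping_cover \<Omega> N \<Omega>s" "partition_of_unity \<Omega> N \<Omega>s pu" "open \<Omega>"
  shows "AE x in lebesgue_on \<Omega>.
      (\<Sum>l=1..N. zero_ext (\<Omega>s l) (\<lambda>y. of_real (pu l y) * w l y) x) =
      u x + (\<Sum>l=1..N. zero_ext (\<Omega>s l) (\<lambda>y. of_real (pu l y) * (w l y - u y)) x)"
proof -
  have "negligible (\<Union>l\<in>{1..N}. frontier (\<Omega>s l))"
    using assms(1)
    by (intro negligible_Union finite_imageI) (auto intro!: negligible_frontier_lipschitz
       simp: overlapping_cover_def lipschitz_polyhedral_domain_def)
  then have "AE x in lebesgue. x \<notin> (\<Union>l\<in>{1..N}. frontier (\<Omega>s l))"
    using negligible_iff_null_sets AE_not_in by blast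
  then have "AE x in lebesgue_on \<Omega>. x \<in> \<Omega> \<and> x \<notin> (\<Union>l\<in>{1..N}. frontier (\<Omega>s l))"
    using assms(3) by (subst AE_restrict_space_iff) auto
  then show ?thesis
  proof eventually_elim
    case (elim x)
    have "(\<Sum>l=1..N. zero_ext (\<Omega>s l) (\<lambda>y. of_real (pu l y) * w l y) x)
        = (\<Sum>l=1..N. zero_ext (\<Omega>s l) (\<lambda>y. of_real (pu l y)) x * u x
            + zero_ext (\<Omega>s l) (\<lambda>y. of_real (pu l y) * (w l y - u y)) x)"
      by (intro sum.cong refl) (simp add: zero_ext_def algebra_simps)
    also have "\<dots> = (\<Sum>l=1..N. zero_ext (\<Omega>s l) (\<lambda>y. of_real (pu l y)) x) * u x
        + (\<Sum>l=1..N. zero_ext (\<Omega>s l) (\<lambda>y. of_real (pu l y) * (w l y - u y)) x)"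
      by (simp add: sum.distrib sum_distrib_right)
    finally show ?case
      using partition_of_unity_zero_ext[OF assms(2), of x] elim by simp
  qed
qed

section \<open>The discrete operators\<close>

lemma node_ext_in_space:
  assumes "nodal_space V I xn"
  shows "node_ext V I xn S v \<in> V"
proof -
  have "\<exists>!w. w \<in> V \<and> (\<forall>j\<in>I. w (xn j) = (if j \<in> local_nodes I xn S then v (xn j) else 0))"
    using assms[unfolded nodal_space_def, THEN spec,
        of "\<lambda>j. if j \<in> local_nodes I xn S then v (xn j) else 0"] .
  from theI'[OF this] show ?thesis
    unfolding node_ext_def by (rule conjunct1)
qed

text \<open>
  The operators produce functionals normalised to vanish off \<open>V\<close>, so a variational equation tested on
  \<open>V\<close> is an equality of functionals as soon as the right-hand side is normalised too.\<close>

lemma A_inv_eq: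
  assumes "inj_on (A_op k D V) V" "d \<in> V" "\<And>v. v \<in> V \<Longrightarrow> a_form k D d v = G v" "\<And>v. v \<notin> V \<Longrightarrow> G v = 0"
  shows "A_inv k D V G = d"
proof -
  have "A_op k D V d = G"
    using assms(3,4) by (auto simp: A_op_def functional_on_def)
  then show ?thesis
    unfolding A_inv_def using inv_into_f_f[OF assms(1,2)] by simp
qed

theorem mainTheorem1:
  fixes \<Omega> :: "(real^'d) set" and \<Omega>s :: "nat \<Rightarrow> (real^'d) set" and N p :: nat
    and pu :: "nat \<Rightarrow> real^'d \<Rightarrow> real" and k :: real
    and f g :: "real^'d \<Rightarrow> complex"
    and \<T> :: "(real^'d) set set" and Vh :: "(real^'d \<Rightarrow> complex) set"
    and I :: "'j set" and xn :: "'j \<Rightarrow> real^'d"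
    and Vl :: "nat \<Rightarrow> (real^'d \<Rightarrow> complex) set"
    and Ah Fh Al Rl Rlt Rltw Binv
  assumes dim: "CARD('d) = 2 \<or> CARD('d) = 3"
    and domain: "lipschitz_polyhedral_domain \<Omega>"
    and cover: "overlapping_cover \<Omega> N \<Omega>s"
    and pou: "partition_of_unity \<Omega> N \<Omega>s pu"
    and wavenumber: "k > 0"
    and data: "f \<in> L2 (lebesgue_on \<Omega>)" "g \<in> L2 (surf (frontier \<Omega>))"
    and impedance_fact: "\<forall>l\<in>{1..N}. \<forall>v\<in>U_space \<Omega>. \<exists>h. has_normal_derivative (\<Omega>s l) v h"
    and fe: "fe_space \<Omega> \<T> p Vh I xn"
    and mesh_resolves: "\<forall>l\<in>{1..N}. \<exists>\<S>\<subseteq>\<T>. closure (\<Omega>s l) = \<Union>\<S>"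
    and Vl: "Vl = (\<lambda>l. local_space Vh (closure (\<Omega>s l)))"
    and local_nodal: "\<forall>l\<in>{1..N}. nodal_space (Vl l) (local_nodes I xn (closure (\<Omega>s l))) xn"
    and Ah: "Ah = A_op k \<Omega> Vh"
    and Fh: "Fh = functional_on Vh (F_form \<Omega> f g)"
    and Al: "Al = (\<lambda>l. A_op k (\<Omega>s l) (Vl l))"
    and Al_invertible: "\<forall>l\<in>{1..N}. bij_betw (Al l) (Vl l) (antidual (Vl l))"
    and Rlt: "Rlt = (\<lambda>l. node_ext Vh I xn (closure (\<Omega>s l)))"
    and Rltw: "Rltw = (\<lambda>l. weighted_ext Vh I xn (closure (\<Omega>s l)) (pu l))"
    and Rl: "Rl = (\<lambda>l. restrict_op Vh I xn (closure (\<Omega>s l)))"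
    and Binv: "Binv = oras k N \<Omega>s pu Vh I xn"
  shows "(\<forall>un ul unext \<delta>.
        un \<in> U_space \<Omega> \<and>
        (\<forall>l\<in>{1..N}. ul l \<in> U_space (\<Omega>s l) \<and>
           (AE x in lebesgue_on (\<Omega>s l).
              - (laplacian (\<Omega>s l) (ul l) x + (of_real k)\<^sup>2 * ul l x) = f x) \<and>
           (AE x in surf (frontier (\<Omega>s l) - frontier \<Omega>).
              impedance_trace k (\<Omega>s l) (ul l) x = impedance_trace k (\<Omega>s l) un x) \<and>
           (AE x in surf (frontier (\<Omega>s l) \<inter> frontier \<Omega>).
              impedance_trace k (\<Omega>s l) (ul l) x = g x)) \<and>
        unext = (\<lambda>x. \<Sum>l=1..N. zero_ext (\<Omega>s l) (\<lambda>y. of_real (pu l y) * ul l y) x) \<and>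
        \<delta> = (\<lambda>l x. ul l x - un x)
      \<longrightarrow>
        (AE x in lebesgue_on \<Omega>.
           unext x = un x + (\<Sum>l=1..N. zero_ext (\<Omega>s l) (\<lambda>y. of_real (pu l y) * \<delta> l y) x)) \<and>
        (\<forall>l\<in>{1..N}. \<forall>vl\<in>H1 (\<Omega>s l).
           a_form k (\<Omega>s l) (\<delta> l) vl =
             (LINT x|lebesgue_on (\<Omega>s l). f x * cnj (vl x))
             + (LINT x|surf (frontier (\<Omega>s l) \<inter> frontier \<Omega>). g x * cnj (bdry_trace (\<Omega>s l) vl x))
             + (LINT x|lebesgue_on (\<Omega>s l). (laplacian \<Omega> un x + (of_real k)\<^sup>2 * un x) * cnj (vl x))
             - (LINT x|surf (frontier (\<Omega>s l) \<inter> frontier \<Omega>).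
                  impedance_trace k (\<Omega>s l) un x * cnj (bdry_trace (\<Omega>s l) vl x))) \<and>
        (\<forall>l\<in>{1..N}. \<forall>vhl\<in>Vl l.
           (LINT x|lebesgue_on \<Omega>. (laplacian \<Omega> un x + (of_real k)\<^sup>2 * un x) * cnj (Rlt l vhl x))
           - (LINT x|surf (frontier \<Omega>). impedance_trace k \<Omega> un x * cnj (bdry_trace \<Omega> (Rlt l vhl) x))
           = - a_form k \<Omega> un (Rlt l vhl)))
    \<and>
    (\<forall>uhn \<delta>h uhnext.
        uhn \<in> Vh \<and>
        (\<forall>l\<in>{1..N}. \<delta>h l \<in> Vl l \<and>
           (\<forall>vhl\<in>Vl l. a_form k (\<Omega>s l) (\<delta>h l) vhl = Rl l Fh vhl - a_form k \<Omega> uhn (Rlt l vhl))) \<and>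
        uhnext = (\<lambda>x. uhn x + (\<Sum>l=1..N. Rltw l (\<delta>h l) x))
      \<longrightarrow>
        (\<forall>l\<in>{1..N}. \<delta>h l = A_inv k (\<Omega>s l) (Vl l) (Rl l (\<lambda>v. Fh v - Ah uhn v))) \<and>
        uhnext = (\<lambda>x. uhn x + Binv (\<lambda>v. Fh v - Ah uhn v) x))"
proof -
  have \<Omega>: "open \<Omega>"
    using domain by (simp add: lipschitz_polyhedral_domain_def)
  have \<Omega>s: "open (\<Omega>s l)" "\<Omega>s l \<subseteq> \<Omega>" if "l \<in> {1..N}" for l
    using cover that by (auto simp: overlapping_cover_def lipschitz_polyhedral_domain_def)
  have Vh: "Vh \<subseteq> H1 \<Omega>" "nodal_space Vh I xn"
    using fe by (auto simp: fe_space_def)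
  have Rlt_in: "Rlt l v \<in> Vh" for l v
    unfolding Rlt by (rule node_ext_in_space[OF Vh(2)])
  have local_solve: "d = A_inv k (\<Omega>s l) (Vl l) (Rl l (\<lambda>v. Fh v - Ah u v))"
    if l: "l \<in> {1..N}" and d: "d \<in> Vl l"
      and eq: "\<forall>v\<in>Vl l. a_form k (\<Omega>s l) d v = Rl l Fh v - a_form k \<Omega> u (Rlt l v)" for l d u
  proof (rule A_inv_eq[symmetric])
    show "inj_on (A_op k (\<Omega>s l) (Vl l)) (Vl l)"
      using bspec[OF Al_invertible l] by (simp add: Al bij_betw_def)
    show "a_form k (\<Omega>s l) d v = Rl l (\<lambda>v. Fh v - Ah u v) v" if "v \<in> Vl l" for v
      using bspec[OF eq that] that Rlt_in[of l v]
      by (simp add: Rl restrict_op_def functional_on_def Vl Ah A_op_def Rlt)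
    show "Rl l (\<lambda>v. Fh v - Ah u v) v = 0" if "v \<notin> Vl l" for v
      using that by (simp add: Rl restrict_op_def functional_on_def Vl)
  qed (rule d)
  show ?thesis
  proof (intro conjI allI impI ballI, goal_cases)
    case (1 un ul unext \<delta>)
    then have unext: "unext = (\<lambda>x. \<Sum>l=1..N. zero_ext (\<Omega>s l) (\<lambda>y. of_real (pu l y) * ul l y) x)"
      and \<delta>: "\<delta> = (\<lambda>l x. ul l x - un x)"
      by blast+
    show ?case
      unfolding unext \<delta> by (rule glued_correction_AE[OF cover pou \<Omega>])
  next
    case (2 un ul unext \<delta> l vl)
    then have l: "l \<in> {1..N}" and vl: "vl \<in> H1 (\<Omega>s l)" and un: "un \<in> U_space \<Omega>"
      and \<delta>: "\<delta> = (\<lambda>l x. ul l x - un x)"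
      by blast+
    have ul: "ul l \<in> U_space (\<Omega>s l)"
      "AE x in lebesgue_on (\<Omega>s l). - (laplacian (\<Omega>s l) (ul l) x + (of_real k)\<^sup>2 * ul l x) = f x"
      "AE x in surf (frontier (\<Omega>s l) - frontier \<Omega>).
        impedance_trace k (\<Omega>s l) (ul l) x = impedance_trace k (\<Omega>s l) un x"
      "AE x in surf (frontier (\<Omega>s l) \<inter> frontier \<Omega>). impedance_trace k (\<Omega>s l) (ul l) x = g x"
      using 2 l by blast+
    obtain h where h: "has_normal_derivative (\<Omega>s l) un h"
      using impedance_fact l un by blast
    show ?case
      unfolding \<delta>
      by (rule a_form_correction[OF \<Omega>s(1)[OF l] \<Omega> \<Omega>s(2)[OF l] data un h ul vl])
  next
    case (3 un ul unext \<delta> l vhl)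
    then have un: "un \<in> U_space \<Omega>" by blast
    obtain h where "has_normal_derivative \<Omega> un h"
      using U_space_D(3)[OF un] by blast
    from a_form_green[OF \<Omega> U_space_D(1,2)[OF un] this subsetD[OF Vh(1) Rlt_in], of k l vhl]
    show ?case
      by simp
  next
    case (4 uhn \<delta>h uhnext l)
    then show ?case
      by (intro local_solve) blast+
  next
    case (5 uhn \<delta>h uhnext)
    have "(\<Sum>l=1..N. Rltw l (\<delta>h l) x) = Binv (\<lambda>v. Fh v - Ah uhn v) x" for x
      unfolding Binv oras_def
    proof (intro sum.cong refl)
      fix l assume l: "l \<in> {1..N}"
      with 5 have "\<delta>h l = A_inv k (\<Omega>s l) (Vl l) (Rl l (\<lambda>v. Fh v - Ah uhn v))"
        by (intro local_solve) blast+
      then show "Rltw l (\<delta>h l) x = weighted_ext Vh I xn (closure (\<Omega>s l)) (pu l)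
          (A_inv k (\<Omega>s l) (local_space Vh (closure (\<Omega>s l)))
            (restrict_op Vh I xn (closure (\<Omega>s l)) (\<lambda>v. Fh v - Ah uhn v))) x"
        by (simp add: Rltw Vl Rl)
    qed
    moreover have "uhnext = (\<lambda>x. uhn x + (\<Sum>l=1..N. Rltw l (\<delta>h l) x))"
      using 5 by blast
    ultimately show ?case
      by simp
  qed
qed

end
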